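(* Let $Z$ be a random variable with the limiting Quicksort distribution. (i) Let $\gamma := \left(2-\frac{1}{\ln 2}\right)^{-1}$. As $x\to\infty$, $$\exp\left(-e^{\gamma x+\ln\ln x+O(1)}\right)\le \mathbb{P}(Z\le -x)\le \exp\left(-e^{\gamma x+O(1)}\right).$$ (ii) As $x\to\infty$, $$\exp\left(-x\ln x-x\ln\ln x+O(x)\right)\le \mathbb{P}(Z\ge x)\le \exp\left(-x\ln x+O(x)\right).$$ Here each $O(1)$ (respectively $O(x)$) stands for some function $r(x)$, possibly different at each occurrence, for which there are constants $C$ and $x_0$ with $|r(x)|\le C$ (respectively $|r(x)|\le Cx$) for all $x\ge x_0$; the inequalities hold for all sufficiently large real $x$.
   Context: The limiting Quicksort distribution is defined as follows. Let $X_n$ be the number of comparisons used by Quicksort when sorting $n$ distinct numbers in uniformly random order; equivalently, the distributions of $X_0,X_1,\dots$ are defined recursively by $X_0=0$ and, for $n\ge1$, $$X_n \overset{\mathrm d}{=} X_{U_n-1}+X^*_{n-U_n}+n-1,$$ where $\overset{\mathrm d}{=}$ denotes equality in distribution and, on the right-hand side, $U_n$ is uniform on $\{1,\dots,n\}$, $X_j^*\overset{\mathrm d}{=}X_j$, and $U_n,X_0,\dots,X_{n-1},X_0^*,\dots,X_{n-1}^*$ are all independent. The normalized variables $Z_n:=(X_n-\mathbb{E}X_n)/n$ converge in distribution as $n\to\infty$ (known, Régnier and Rösler), and $Z$ denotes a random variable having the limit distribution. Equivalently (known, Rösler), the distribution of $Z$ is the unique probability distribution on $\mathbb{R}$ with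 $\mathbb{E}Z=0$, $\operatorname{Var}Z<\infty$ and $$Z\overset{\mathrm d}{=}UZ'+(1-U)Z''+g(U),$$ where $U,Z',Z''$ are independent, $U$ is uniform on $(0,1)$, $Z'\overset{\mathrm d}{=}Z''\overset{\mathrm d}{=}Z$, and $g(u):=2u\ln u+2(1-u)\ln(1-u)+1$ (with $0\ln 0=0$). It is also known that $\mathbb{E}e^{tZ}<\infty$ for every real $t$. *)

theory Defs
  imports "HOL-Probability.Probability" "HOL-Library.Landau_Symbols"
begin

function quicksort_comparisons :: "nat \<Rightarrow> nat pmf" where
  "quicksort_comparisons n =
     (if n = 0 then return_pmf 0
      else bind_pmf (pmf_of_set {1..n}) (\<lambda>u.
             bind_pmf (quicksort_comparisons (u - 1)) (\<lambda>x.
               bind_pmf (quicksort_comparisons (n - u)) (\<lambda>y.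
                 return_pmf (x + y + (n - 1))))))"
  by auto
termination
  by (relation "Wellfounded.measure (\<lambda>n. n)") (auto simp: set_pmf_of_set)

declare quicksort_comparisons.simps [simp del]

definition quicksort_mean :: "nat \<Rightarrow> real" where
  "quicksort_mean n = measure_pmf.expectation (quicksort_comparisons n) real"

text \<open>
  The law of \<open>(X\<^sub>n - E X\<^sub>n) / n\<close> as a Borel measure on the reals. Its value at \<open>n = 0\<close> (a point
  mass at 0, by the division convention) is irrelevant for the limit.
\<close>
definition quicksort_normalized :: "nat \<Rightarrow> real measure" where
  "quicksort_normalized n =
     distr (measure_pmf (quicksort_comparisons n)) borel
       (\<lambda>k. (real k - quicksort_mean n) / real n)"

definition limiting_quicksort_distribution :: "real measure \<Rightarrow> bool" where
  "limiting_quicksort_distribution \<mu> \<longleftrightarrow>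
     real_distribution \<mu> \<and> weak_conv_m quicksort_normalized \<mu>"

end

theory Submission
  imports Defs "HOL-Real_Asymp.Real_Asymp"
begin

text \<open>
  Everything is proved for the finite variables \<open>X\<^sub>n\<close>, with bounds that are uniform in \<open>n\<close> (upper
  bounds) or hold for all large \<open>n\<close> (lower bounds). They survive weak convergence after a shift of
  the argument by a constant, which the error terms absorb.

  Put \<open>Y\<^sub>n = (X\<^sub>n - E X\<^sub>n) / (n + 1)\<close>. If the pivot has rank \<open>p\<close> and \<open>a = p / (n + 1)\<close>, then
  \<open>Y\<^sub>n = a Y' + (1 - a) Y'' + G\<close> with independent deviations \<open>Y'\<close> and \<open>Y''\<close> of the two subproblems. The
  toll \<open>G\<close> has mean 0, satisfies \<open>|G| \<le> 1\<close>, and lies between \<open>1 - 2 h(a)\<close> and \<open>1 - 2 h(a) + 4 / (n + 1)\<close>,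
  where \<open>h\<close> is the binary entropy (lemmas \<open>sum_split_toll\<close>, \<open>abs_split_toll_le_1\<close> and
  \<open>split_toll_entropy\<close>).

  Upper bounds. Induction on \<open>n\<close> gives \<open>E exp (t Y\<^sub>n) \<le> exp (100 (exp |t| - 1))\<close>
  (\<open>qs_mgf_le_exp_exp\<close>), because \<open>exp (a s) + exp ((1 - a) s)\<close> falls short of \<open>exp s + 1\<close> by a product that
  outweighs the toll on average over \<open>a\<close>. The Chernoff bound at \<open>t = ln x\<close> yields the right tail. On
  the left, let \<open>\<kappa> = 2 - 1 / ln 2\<close>, so that \<open>\<gamma> = 1 / \<kappa>\<close>. The function \<open>\<kappa> t ln t\<close> loses \<open>\<kappa> t h(a)\<close> in a split,
  while \<open>- t G \<le> t (2 h(a) - 1)\<close>; the sum \<open>t ((2 - \<kappa>) h(a) - 1)\<close> is at most 0, with equality only at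
  \<open>a = 1/2\<close>. Hence \<open>E exp (- t Y\<^sub>n) \<le> exp (\<kappa> t ln t + c t + 1)\<close> (\<open>qs_mgf_left\<close>), and the Chernoff bound with
  \<open>\<kappa> ln t = x - O(1)\<close> yields the left tail.

  Lower bounds. A balanced split of two low subproblems lowers \<open>Y\<close> by about \<open>2 ln 2 - 1\<close> and roughly
  squares the probability; about \<open>x / (2 ln 2 - 1)\<close> such steps give the double exponential left tail
  (\<open>qs_prob_left_lower\<close>). A pivot among the smallest fraction \<open>\<delta>\<close> raises \<open>Y\<close> by almost 1 at the cost of a
  factor of order \<open>\<delta>\<close>; about \<open>x\<close> such steps with \<open>\<delta> = 1 / (x ln x)\<close> give the right tail
  (\<open>qs_prob_right_lower\<close>). Both start from the tightness of \<open>Y\<^sub>n\<close>.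
\<close>

section \<open>The mean number of comparisons\<close>

lemma finite_set_pmf_quicksort [simp]: "finite (set_pmf (quicksort_comparisons n))"
proof (induction n rule: less_induct)
  case (less n)
  show ?case
    by (subst quicksort_comparisons.simps) (auto intro!: finite_UN_I less)
qed

lemma integrable_quicksort [simp]:
  "integrable (measure_pmf (quicksort_comparisons n)) (f :: nat \<Rightarrow> real)"
  by (rule integrable_measure_pmf_finite) simp

lemma expectation_bind_finite:
  fixes h :: "'b \<Rightarrow> real"
  assumes "finite (set_pmf p)" "\<And>x. x \<in> set_pmf p \<Longrightarrow> finite (set_pmf (f x))"
  shows "measure_pmf.expectation (bind_pmf p f) h =
    measure_pmf.expectation p (\<lambda>x. measure_pmf.expectation (f x) h)"
  using assms by (simp add: pmf_expectation_bind[of "set_pmf p"] integral_measure_pmf[of "set_pmf p"])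

text \<open>
  Every later statement about \<open>X\<^sub>n\<close>, be it about its mean, its exponential moments or its tail
  probabilities, comes from this conditioning on the rank \<open>p\<close> of the pivot.
\<close>
lemma quicksort_expectation_rec:
  fixes f :: "nat \<Rightarrow> real"
  assumes "n \<ge> 1"
  shows "measure_pmf.expectation (quicksort_comparisons n) f =
    (\<Sum>p\<in>{1..n}. measure_pmf.expectation (quicksort_comparisons (p - 1)) (\<lambda>x.
       measure_pmf.expectation (quicksort_comparisons (n - p)) (\<lambda>y. f (x + y + (n - 1))))) / n"
  using assms
  by (subst quicksort_comparisons.simps)
     (simp add: integral_pmf_of_set expectation_bind_finite)

lemma quicksort_mean_0: "quicksort_mean 0 = 0"
  by (simp add: quicksort_mean_def quicksort_comparisons.simps)

lemma quicksort_mean_split_rec: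
  assumes "n \<ge> 1"
  shows "quicksort_mean n =
    (\<Sum>p\<in>{1..n}. quicksort_mean (p - 1) + quicksort_mean (n - p)) / n + (real n - 1)"
proof -
  have "quicksort_mean n =
    (\<Sum>p\<in>{1..n}. quicksort_mean (p - 1) + quicksort_mean (n - p) + (real n - 1)) / n"
    unfolding quicksort_mean_def using assms
    by (subst quicksort_expectation_rec) (auto simp: of_nat_diff add_diff_eq)
  also have "\<dots> = (\<Sum>p\<in>{1..n}. quicksort_mean (p - 1) + quicksort_mean (n - p)) / n + (real n - 1)"
    using assms by (simp add: sum.distrib add_divide_distrib)
  finally show ?thesis .
qed

lemma sum_harm_shift:
  "(\<Sum>i<n. 2 * (real i + 1) * harm (i + 1) - 2 - 4 * real i) =
     real n * (real n + 1) * harm (n + 1) - 5/2 * real n ^ 2 - real n / 2"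
proof (induction n)
  case (Suc n)
  have "(real n + 2) * harm (Suc n + 1) = (real n + 2) * harm (n + 1) + 1"
    by (subst (1) add.commute) (simp add: harm_Suc[of "Suc n"] field_simps)
  then have "(real n + 1) * ((real n + 2) * harm (Suc n + 1)) = (real n + 1) * ((real n + 2) * harm (n + 1) + 1)"
    by simp
  with Suc show ?case by (simp add: algebra_simps add_divide_distrib power2_eq_square del: One_nat_def)
qed simp

text \<open>
  The usual closed form \<open>2 (n + 1) H\<^sub>n - 4 n\<close>, written with \<open>H\<^bsub>n+1\<^esub>\<close>. In this form the toll of a split at
  rank \<open>p\<close> is a difference of values \<open>m H\<^sub>m\<close> at \<open>m = n + 1\<close>, \<open>p\<close> and \<open>n + 1 - p\<close>, and the last two
  numbers add up to the first.
\<close>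
lemma quicksort_mean_harm: "quicksort_mean n = 2 * (real n + 1) * harm (n + 1) - 2 - 4 * real n"
proof (induction n rule: less_induct)
  case (less n)
  show ?case
  proof (cases "n = 0")
    case True
    then show ?thesis by (simp add: quicksort_mean_0 harm_expand)
  next
    case False
    have 1: "(\<Sum>p\<in>{1..n}. quicksort_mean (p - 1)) = (\<Sum>i<n. quicksort_mean i)"
      by (rule sum.reindex_bij_witness[of _ Suc "\<lambda>p. p - 1"]) auto
    have 2: "(\<Sum>p\<in>{1..n}. quicksort_mean (n - p)) = (\<Sum>i<n. quicksort_mean i)"
      by (rule sum.reindex_bij_witness[of _ "\<lambda>i. n - i" "\<lambda>p. n - p"]) auto
    have 3: "(\<Sum>i<n. quicksort_mean i) = (\<Sum>i<n. 2 * (real i + 1) * harm (i + 1) - 2 - 4 * real i)"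
      using less by (intro sum.cong) auto
    have "quicksort_mean n = 2 * (\<Sum>i<n. quicksort_mean i) / n + (real n - 1)"
      using False by (subst quicksort_mean_split_rec) (auto simp: sum.distrib 1 2 simp del: One_nat_def)
    also have "\<dots> = 2 * (real n + 1) * harm (n + 1) - 2 - 4 * real n"
      unfolding 3 sum_harm_shift using False by (simp add: field_simps power2_eq_square)
    finally show ?thesis .
  qed
qed

section \<open>The toll of a split and the binary entropy\<close>

text \<open>
  The discrete counterpart of the function \<open>g\<close> in the fixed point equation of the limit law. The
  denominator is \<open>n + 1\<close> so that the weights \<open>p / (n + 1)\<close> and \<open>(n + 1 - p) / (n + 1)\<close> of the two
  subproblems, of sizes \<open>p - 1\<close> and \<open>n - p\<close>, add up to exactly 1.
\<close>
definition split_toll :: "nat \<Rightarrow> nat \<Rightarrow> real" where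
  "split_toll n p =
     (real n - 1 + quicksort_mean (p - 1) + quicksort_mean (n - p) - quicksort_mean n) / (real n + 1)"

lemma sum_split_toll: "(\<Sum>p\<in>{1..n}. split_toll n p) = 0"
proof (cases "n = 0")
  case False
  have "(\<Sum>p\<in>{1..n}. split_toll n p) =
     (n * (real n - 1) + (\<Sum>p\<in>{1..n}. quicksort_mean (p - 1) + quicksort_mean (n - p)) - n * quicksort_mean n) / (real n + 1)"
    by (simp add: split_toll_def sum.distrib sum_subtractf flip: sum_divide_distrib)
  also have "\<dots> = 0"
    using False quicksort_mean_split_rec[of n] by (simp add: field_simps)
  finally show ?thesis .
qed auto

lemma split_toll_harm:
  assumes "1 \<le> p" "p \<le> n"
  shows "split_toll n p = 1 - 2 * ((real n + 1) * harm (n + 1) - real p * harm p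
            - (real (n + 1) - real p) * harm (n + 1 - p)) / (real n + 1)"
proof -
  have [simp]: "Suc (n - p) = Suc n - p" "p - 1 + 1 = p" using assms by auto
  show ?thesis using assms
    by (simp add: split_toll_def quicksort_mean_harm of_nat_diff divide_simps) (simp add: algebra_simps)
qed

text \<open>
  Together with the next lemma: \<open>H\<^sub>m - ln m\<close> decreases, while \<open>H\<^bsub>m-1\<^esub> - ln m\<close> increases. So replacing
  \<open>m H\<^sub>m\<close> by \<open>m ln m\<close> in the toll costs only a bounded amount and has a favourable sign.
\<close>
lemma harm_diff_ln_decreasing:
  assumes "1 \<le> m" "m \<le> k"
  shows "harm k - ln (real k) \<le> harm m - ln (real m)"
  using assms(2)
proof (induction k rule: dec_induct)
  case (step k)
  have k: "k \<ge> 1" using step assms by auto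
  have "ln (real k / real (Suc k)) \<le> real k / real (Suc k) - 1"
    using k by (intro ln_le_minus_one) auto
  also have "\<dots> = - inverse (real (Suc k))" by (simp add: field_simps)
  finally have "inverse (real (Suc k)) \<le> ln (Suc k) - ln k"
    using k by (simp add: ln_div)
  with step.IH show ?case by (simp add: harm_Suc)
qed auto

lemma harm_diff_ln_lower:
  assumes "1 \<le> m" "m \<le> k"
  shows "harm m - ln (real m) - 1 / m \<le> harm k - ln (real k) - 1 / k"
  using assms(2)
proof (induction k rule: dec_induct)
  case (step k)
  have k: "k \<ge> 1" using step assms by auto
  have "ln (real (Suc k) / k) \<le> real (Suc k) / k - 1"
    using k by (intro ln_le_minus_one) auto
  also have "\<dots> = 1 / k" using k by (simp add: field_simps)
  finally have "ln (Suc k) - ln k \<le> 1 / real k"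
    using k by (simp add: ln_div)
  with step.IH show ?case by (simp add: harm_Suc inverse_eq_divide)
qed auto

definition binary_entropy :: "real \<Rightarrow> real" where
  "binary_entropy a = - (a * ln a) - (1 - a) * ln (1 - a)"

lemma binary_entropy_scaled:
  assumes "0 < p" "p < N"
  shows "N * binary_entropy (p / N) = N * ln N - p * ln p - (N - p) * ln (N - p)"
proof -
  have 1: "1 - p / N = (N - p) / N" using assms by (simp add: field_simps)
  have "N * binary_entropy (p / N) = - (p * ln (p / N)) - (N - p) * ln ((N - p) / N)"
    using assms unfolding binary_entropy_def 1 by (simp add: right_diff_distrib)
  also have "\<dots> = - (p * (ln p - ln N)) - (N - p) * (ln (N - p) - ln N)"
    using assms by (simp add: ln_div)
  finally show ?thesis by (simp add: algebra_simps)
qed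

text \<open>
  With \<open>h\<close> the binary entropy, the limiting toll is \<open>g(u) = 1 - 2 h(u)\<close>. The discrete toll is never
  below this value, which is why the exponential moment on the left needs no error term, and it
  exceeds the value by \<open>O(1/n)\<close> only.
\<close>
lemma split_toll_entropy:
  assumes "1 \<le> p" "p \<le> n"
  shows "1 - 2 * binary_entropy (p / (real n + 1)) \<le> split_toll n p"
    and "split_toll n p \<le> 1 - 2 * binary_entropy (p / (real n + 1)) + 4 / (real n + 1)"
proof -
  define q where "q = n + 1 - p"
  define D where "D m = harm m - ln (real m)" for m :: nat
  have q: "1 \<le> q" "q \<le> n + 1" "p \<le> n + 1" "real (n + 1) - real p = real q" 
      "real n + 1 - real p = real q" "real n + 1 = real p + real q"
    using assms by (auto simp: q_def of_nat_diff)
  have toll: "split_toll n p = 1 - 2 * ((real n + 1) * harm (n + 1) - real p * harm p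
            - real q * harm q) / (real n + 1)"
    using split_toll_harm[OF assms] q by (simp add: q_def add_ac)
  have ent: "(real n + 1) * binary_entropy (p / (real n + 1)) =
      (real n + 1) * ln (real n + 1) - p * ln p - q * ln q"
    using binary_entropy_scaled[of p "real n + 1"] assms q by (simp add: add_ac)
  have eq: "(real n + 1) * harm (n + 1) - real p * harm p - real q * harm q =
      (real n + 1) * binary_entropy (p / (real n + 1)) + (real p * (D (n + 1) - D p) + real q * (D (n + 1) - D q))"
  proof -
    have "(real n + 1) * x = real p * x + real q * x" for x using q(6) by (simp add: algebra_simps)
    then show ?thesis unfolding ent D_def by (simp add: right_diff_distrib add_ac)
  qed
  have "D (n + 1) - D p \<le> 0" "D (n + 1) - D q \<le> 0"
    unfolding D_def using harm_diff_ln_decreasing[of p "n + 1"] harm_diff_ln_decreasing[of q "n + 1"] assms q by auto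
  then have 1: "real p * (D (n + 1) - D p) + real q * (D (n + 1) - D q) \<le> 0"
    by (intro add_nonpos_nonpos mult_nonneg_nonpos) auto
  have low: "real r * (D (n + 1) - D r) \<ge> - 1" if "1 \<le> r" "r \<le> n + 1" for r
  proof -
    have "D (n + 1) - D r \<ge> - (1 / r) + 1 / real (n + 1)"
      unfolding D_def using harm_diff_ln_lower[OF that] by linarith
    moreover have "1 / real (n + 1) \<ge> 0" by simp
    ultimately have "D (n + 1) - D r \<ge> - (1 / r)" by linarith
    then have "real r * (D (n + 1) - D r) \<ge> real r * (- (1 / r))" by (intro mult_left_mono) auto
    with that show ?thesis by simp
  qed
  have 2: "real p * (D (n + 1) - D p) + real q * (D (n + 1) - D q) \<ge> - 2"
    using low[of p] low[of q] assms q by auto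
  define W where "W = real p * (D (n + 1) - D p) + real q * (D (n + 1) - D q)"
  have "split_toll n p = 1 - 2 * binary_entropy (p / (real n + 1)) - 2 * W / (real n + 1)"
    unfolding toll eq W_def[symmetric] by (simp add: add_divide_distrib)
  moreover have "2 * W / (real n + 1) \<le> 0" 
    using 1 unfolding W_def[symmetric] by (intro divide_nonpos_pos) auto
  moreover have "(- 4) / (real n + 1) \<le> 2 * W / (real n + 1)"
    using 2 unfolding W_def[symmetric] by (intro divide_right_mono) auto
  ultimately show "1 - 2 * binary_entropy (p / (real n + 1)) \<le> split_toll n p"
    and "split_toll n p \<le> 1 - 2 * binary_entropy (p / (real n + 1)) + 4 / (real n + 1)"
    by auto
qed

text \<open>
  Quadratic decay of the entropy away from its maximum at 1/2. The inequality \<open>ln y \<le> y - 1\<close> at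
  \<open>y = 1 / sqrt (2 x)\<close> reduces it to an upper bound on \<open>sqrt a + sqrt (1 - a)\<close>.
\<close>
lemma binary_entropy_le_ln2:
  assumes "0 < a" "a < 1"
  shows "binary_entropy a \<le> ln 2 - (2 * a - 1)\<^sup>2 / 4"
proof -
  have key: "x * ln (2 * x) \<ge> 2 * x - sqrt 2 * sqrt x" if "x > 0" for x :: real
  proof -
    have "ln (1 / sqrt (2 * x)) \<le> 1 / sqrt (2 * x) - 1" using that by (intro ln_le_minus_one) auto
    then have "ln (2 * x) \<ge> 2 - 2 / sqrt (2 * x)" using that by (simp add: ln_div ln_sqrt)
    then have "x * ln (2 * x) \<ge> x * (2 - 2 / sqrt (2 * x))" using that by (intro mult_left_mono) auto
    also have "x * (2 - 2 / sqrt (2 * x)) = 2 * x - sqrt 2 * sqrt x"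
      using that by (simp add: field_simps real_sqrt_mult)
    finally show ?thesis .
  qed
  define s where "s = sqrt a + sqrt (1 - a)"
  define z where "z = 2 * a - 1"
  have s0: "s \<ge> 0" using assms by (simp add: s_def)
  have prod: "2 * sqrt a * sqrt (1 - a) \<le> 1 - z\<^sup>2 / 2"
  proof -
    have "(2 * sqrt a * sqrt (1 - a))\<^sup>2 = 1 - z\<^sup>2"
      using assms by (simp add: power_mult_distrib z_def) (simp add: power2_eq_square algebra_simps)
    also have "\<dots> \<le> (1 - z\<^sup>2 / 2)\<^sup>2"
      using zero_le_power2[of "z\<^sup>2"] by (simp add: power2_diff power_divide)
    finally show ?thesis
    proof (rule power2_le_imp_le)
      have "z\<^sup>2 \<le> 1" using assms by (simp add: z_def abs_square_le_1)
      then show "0 \<le> 1 - z\<^sup>2 / 2" by simp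
    qed
  qed
  have "(sqrt 2 * s)\<^sup>2 = 2 * (1 + 2 * sqrt a * sqrt (1 - a))"
    using assms by (simp add: s_def power_mult_distrib power2_sum)
  also have "\<dots> \<le> 4 - z\<^sup>2" using prod by simp
  also have "\<dots> \<le> (2 - z\<^sup>2 / 4)\<^sup>2"
    using zero_le_power2[of "z\<^sup>2"] by (simp add: power2_diff power_divide)
  finally have "sqrt 2 * s \<le> 2 - z\<^sup>2 / 4"
  proof (rule power2_le_imp_le)
    have "z\<^sup>2 \<le> 1" using assms by (simp add: z_def abs_square_le_1)
    then show "0 \<le> 2 - z\<^sup>2 / 4" by simp
  qed
  moreover have "a * ln (2 * a) + (1 - a) * ln (2 * (1 - a)) \<ge> 2 - sqrt 2 * s"
    using key[of a] key[of "1 - a"] assms by (simp add: s_def algebra_simps)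
  moreover have "a * ln (2 * a) + (1 - a) * ln (2 * (1 - a)) = ln 2 - binary_entropy a"
    using assms by (simp only: ln_mult binary_entropy_def) (simp add: algebra_simps ln_mult)
  ultimately show ?thesis by (simp add: z_def)
qed

lemma binary_entropy_ge_ln2:
  assumes "0 < a" "a < 1"
  shows "binary_entropy a \<ge> ln 2 - (2 * a - 1)\<^sup>2"
proof -
  have "a * ln (2 * a) \<le> a * (2 * a - 1)" "(1 - a) * ln (2 * (1 - a)) \<le> (1 - a) * (2 * (1 - a) - 1)"
    using assms by (intro mult_left_mono ln_le_minus_one; simp)+
  moreover have "a * ln (2 * a) + (1 - a) * ln (2 * (1 - a)) = ln 2 - binary_entropy a"
    using assms by (simp only: ln_mult binary_entropy_def) (simp add: algebra_simps ln_mult)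
  ultimately show ?thesis by (simp add: power2_eq_square algebra_simps)
qed

text \<open>
  The toll is \<open>1 - 2 X / (n + 1)\<close> with \<open>X = p (H\<^bsub>p+q\<^esub> - H\<^sub>p) + q (H\<^bsub>p+q\<^esub> - H\<^sub>q)\<close>, and
  \<open>H\<^bsub>p+q\<^esub> - H\<^sub>p \<le> q / p\<close> gives \<open>0 \<le> X \<le> p + q = n + 1\<close>. The sharp constant 1 in the upper bound is what makes
  the right tail \<open>exp (- x ln x)\<close> rather than some other multiple of \<open>x ln x\<close>.
\<close>
lemma abs_split_toll_le_1:
  assumes "1 \<le> p" "p \<le> n"
  shows "\<bar>split_toll n p\<bar> \<le> 1"
proof -
  define q where "q = n + 1 - p"
  have q: "1 \<le> q" "q \<le> n + 1" "p \<le> n + 1" "real (n + 1) - real p = real q" 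
      "real n + 1 = real p + real q" "n + 1 = p + q"
    using assms by (auto simp: q_def of_nat_diff)
  define X where "X = real p * (harm (n + 1) - harm p) + real q * (harm (n + 1) - harm q)"
  have toll: "split_toll n p = 1 - 2 * X / (real n + 1)"
    using split_toll_harm[OF assms] q by (simp add: q_def X_def) (simp add: algebra_simps)
  have gap: "harm (a + b) - harm a \<le> real b / a" if "a \<ge> 1" for a b :: nat
  proof (induction b)
    case (Suc b)
    have "inverse (real (Suc (a + b))) \<le> 1 / a" using that by (simp add: field_simps)
    with Suc that show ?case by (simp add: harm_Suc add_divide_distrib)
  qed auto
  have "X \<ge> 0" unfolding X_def using q assms
    by (intro add_nonneg_nonneg mult_nonneg_nonneg) (auto intro!: harm_mono)
  moreover have "X \<le> real n + 1"
  proof -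
    have "real p * (harm (n + 1) - harm p) \<le> real p * (real q / p)"
      unfolding q(6) using gap[of p q] assms by (intro mult_left_mono) auto
    moreover have "real q * (harm (n + 1) - harm q) \<le> real q * (real p / q)"
      unfolding q(6) using gap[of q p] q(1) by (intro mult_left_mono) (auto simp: add_ac)
    ultimately show ?thesis using assms q unfolding X_def by simp
  qed
  ultimately show ?thesis unfolding toll by (simp add: abs_le_iff field_simps)
qed

section \<open>Recursion for the normalised deviation\<close>

text \<open>
  The deviation is divided by \<open>n + 1\<close> and not by \<open>n\<close>, so that its recursion has weights with sum 1;
  the two normalisations have the same limit.
\<close>
definition qs_dev :: "nat \<Rightarrow> nat \<Rightarrow> real" where
  "qs_dev n x = (real x - quicksort_mean n) / (real n + 1)"

lemma qs_dev_split:
  assumes "1 \<le> p" "p \<le> n"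
  shows "qs_dev n (x + y + (n - 1)) = p / (real n + 1) * qs_dev (p - 1) x
    + (1 - p / (real n + 1)) * qs_dev (n - p) y + split_toll n p"
proof -
  have 1: "1 - p / (real n + 1) = (real n + 1 - p) / (real n + 1)" by (simp add: field_simps)
  have 2: "real (n - p) + 1 = real n + 1 - p" "real (p - 1) + 1 = real p" using assms by auto
  have "p / (real n + 1) * qs_dev (p - 1) x = (real x - quicksort_mean (p - 1)) / (real n + 1)"
    "(1 - p / (real n + 1)) * qs_dev (n - p) y = (real y - quicksort_mean (n - p)) / (real n + 1)"
    unfolding 1 qs_dev_def 2 using assms by auto
  moreover have "real (x + y + (n - 1)) = real x + real y + (real n - 1)" using assms by auto
  ultimately show ?thesis
    unfolding qs_dev_def split_toll_def by (simp flip: add_divide_distrib)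
qed

definition qs_mgf :: "nat \<Rightarrow> real \<Rightarrow> real" where
  "qs_mgf n t = measure_pmf.expectation (quicksort_comparisons n) (\<lambda>x. exp (t * qs_dev n x))"

lemma qs_mgf_nonneg: "qs_mgf n t \<ge> 0"
  unfolding qs_mgf_def by (rule Bochner_Integration.integral_nonneg) auto

lemma qs_mgf_0: "qs_mgf 0 t = 1"
  by (simp add: qs_mgf_def qs_dev_def quicksort_mean_0 quicksort_comparisons.simps)

lemma qs_mgf_rec:
  assumes "n \<ge> 1"
  shows "qs_mgf n t = (\<Sum>p\<in>{1..n}. exp (t * split_toll n p) *
    (qs_mgf (p - 1) (p / (real n + 1) * t) * qs_mgf (n - p) ((1 - p / (real n + 1)) * t))) / n"
proof -
  have "measure_pmf.expectation (quicksort_comparisons (p - 1)) (\<lambda>x.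
      measure_pmf.expectation (quicksort_comparisons (n - p)) (\<lambda>y. exp (t * qs_dev n (x + y + (n - 1)))))
    = exp (t * split_toll n p) *
    (qs_mgf (p - 1) (p / (real n + 1) * t) * qs_mgf (n - p) ((1 - p / (real n + 1)) * t))"
    if "p \<in> {1..n}" for p
  proof -
    have "exp (t * qs_dev n (x + y + (n - 1))) = exp (t * split_toll n p) *
       (exp ((p / (real n + 1) * t) * qs_dev (p - 1) x) * exp (((1 - p / (real n + 1)) * t) * qs_dev (n - p) y))" for x y
      using that by (subst qs_dev_split) (auto simp: algebra_simps simp flip: exp_add)
    then show ?thesis by (simp add: qs_mgf_def)
  qed
  then show ?thesis
    unfolding qs_mgf_def[of n]
    by (subst quicksort_expectation_rec[OF assms], intro arg_cong[where f = "\<lambda>s. s / n"] sum.cong) auto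
qed

text \<open>
  The induction step behind both exponential moment bounds. The bound \<open>exp (A a)\<close> is meant for a
  subproblem that carries the fraction \<open>a\<close> of the whole, so the excess \<open>A a + A (1 - a) - A 1\<close>
  together with the toll must have an exponential that averages to at most 1 over the pivots.
\<close>
lemma qs_mgf_induct_bound:
  assumes "n \<ge> 1"
    and A: "\<And>p. p \<in> {1..n} \<Longrightarrow> qs_mgf (p - 1) (p / (real n + 1) * t) \<le> exp (A (p / (real n + 1)))"
    and B: "\<And>p. p \<in> {1..n} \<Longrightarrow> qs_mgf (n - p) ((1 - p / (real n + 1)) * t) \<le> exp (A (1 - p / (real n + 1)))"
    and sum: "(\<Sum>p\<in>{1..n}. exp (t * split_toll n p + A (p / (real n + 1)) + A (1 - p / (real n + 1)) - A1)) \<le> n"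
  shows "qs_mgf n t \<le> exp A1"
proof -
  have "qs_mgf n t \<le> (\<Sum>p\<in>{1..n}. exp (t * split_toll n p) *
    (exp (A (p / (real n + 1))) * exp (A (1 - p / (real n + 1))))) / n"
    unfolding qs_mgf_rec[OF assms(1)]
    by (intro divide_right_mono sum_mono mult_left_mono mult_mono A B) (auto simp: qs_mgf_nonneg)
  also have "\<dots> = exp A1 * ((\<Sum>p\<in>{1..n}. exp (t * split_toll n p + A (p / (real n + 1)) + A (1 - p / (real n + 1)) - A1)) / n)"
    by (simp add: sum_distrib_left flip: exp_add)
  also have "\<dots> \<le> exp A1 * 1"
    using assms(1) sum by (intro mult_left_mono) (auto simp: divide_le_eq)
  finally show ?thesis by simp
qed

section \<open>A two-sided bound on the moment generating function\<close>

text \<open>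
  Because \<open>exp (a s) exp ((1 - a) s) = exp s\<close>, the left-hand side is
  \<open>exp s + 1 - exp (a s) - exp ((1 - a) s)\<close>, which is concave in \<open>a\<close>, vanishes at \<open>a = 0\<close> and equals
  \<open>(exp (s / 2) - 1)\<^sup>2\<close> at \<open>a = 1/2\<close>; hence it lies above the chord between these
  points. The case \<open>a > 1/2\<close> follows by symmetry.
\<close>
lemma exp_gap_product:
  fixes s a :: real
  assumes "0 \<le> a" "a \<le> 1"
  shows "(exp (a * s) - 1) * (exp ((1 - a) * s) - 1) \<ge> 2 * min a (1 - a) * (exp (s / 2) - 1)\<^sup>2"
proof -
  have main: "(exp (a * s) - 1) * (exp ((1 - a) * s) - 1) \<ge> 2 * a * (exp (s / 2) - 1)\<^sup>2"
    if a: "0 \<le> a" "a \<le> 1/2" for a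
  proof -
    have e: "exp ((1 - (2 * a)) *\<^sub>R x + (2 * a) *\<^sub>R y) \<le> (1 - 2 * a) * exp x + 2 * a * exp y" for x y :: real
      using convex_onD[OF exp_convex, of "2 * a" x y] a by auto
    have "exp (a * s) \<le> (1 - 2 * a) * exp 0 + 2 * a * exp (s / 2)"
      using e[of 0 "s/2"] by (simp add: algebra_simps)
    moreover have "exp ((1 - a) * s) \<le> (1 - 2 * a) * exp s + 2 * a * exp (s / 2)"
      using e[of s "s/2"] by (simp add: algebra_simps)
    moreover have "exp (a * s) * exp ((1 - a) * s) = exp s"
      by (simp add: algebra_simps flip: exp_add)
    moreover have "(exp (s / 2))\<^sup>2 = exp s" by (simp add: power2_eq_square flip: exp_add)
    ultimately show ?thesis by (simp add: power2_eq_square algebra_simps)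
  qed
  show ?thesis
  proof (cases "a \<le> 1/2")
    case True
    then show ?thesis using main[of a] assms by (simp add: min_def)
  next
    case False
    then show ?thesis using main[of "1 - a"] assms by (simp add: min_def mult.commute)
  qed
qed

lemma sum_exp_geometric_le:
  fixes y :: real
  assumes "y > 0"
  shows "(\<Sum>k\<in>{1..n}. exp (- y * real k)) \<le> 1 / y"
proof -
  define r where "r = exp (- y)"
  have r: "0 < r" "r < 1" using assms by (auto simp: r_def)
  have "(\<Sum>k\<in>{1..n}. exp (- y * real k)) = (\<Sum>k<n. r * r ^ k)"
    by (rule sum.reindex_bij_witness[of _ Suc "\<lambda>k. k - 1"])
       (auto simp: r_def exp_of_nat_mult[symmetric] algebra_simps simp flip: exp_add)
  also have "\<dots> = r * ((1 - r ^ n) / (1 - r))"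
    using r by (simp flip: sum_distrib_left add: sum_gp_strict)
  also have "\<dots> \<le> r * (1 / (1 - r))"
    using r by (intro mult_left_mono divide_right_mono) auto
  also have "\<dots> = 1 / (exp y - 1)"
    using assms by (simp add: r_def exp_minus field_simps)
  also have "\<dots> \<le> 1 / y"
  proof -
    have "y \<le> exp y - 1" using exp_ge_add_one_self[of y] by linarith
    then show ?thesis using assms by (intro divide_left_mono) (auto intro!: mult_pos_pos)
  qed
  finally show ?thesis .
qed

lemma sum_exp_min_le:
  fixes y :: real
  assumes "y > 0"
  shows "(\<Sum>p\<in>{1..n}. exp (- y * min (real p) (real n + 1 - real p))) \<le> 2 / y"
proof -
  have "(\<Sum>p\<in>{1..n}. exp (- y * min (real p) (real n + 1 - real p))) \<le>
        (\<Sum>p\<in>{1..n}. exp (- y * real p) + exp (- y * (real n + 1 - real p)))"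
    by (intro sum_mono) (auto simp: min_def)
  also have "\<dots> = (\<Sum>p\<in>{1..n}. exp (- y * real p)) + (\<Sum>p\<in>{1..n}. exp (- y * (real n + 1 - real p)))"
    by (rule sum.distrib)
  also have "(\<Sum>p\<in>{1..n}. exp (- y * (real n + 1 - real p))) = (\<Sum>p\<in>{1..n}. exp (- y * real p))"
    by (rule sum.reindex_bij_witness[of _ "\<lambda>p. n + 1 - p" "\<lambda>p. n + 1 - p"]) (auto simp: of_nat_diff)
  finally show ?thesis using sum_exp_geometric_le[OF assms, of n] by simp
qed

lemma one_minus_exp_concave:
  fixes y z :: real
  assumes "0 \<le> z" "z \<le> 1"
  shows "1 - exp (- (y * z)) \<ge> z * (1 - exp (- y))"
proof -
  have "exp ((1 - z) *\<^sub>R 0 + z *\<^sub>R (- y)) \<le> (1 - z) * exp 0 + z * exp (- y)"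
    using convex_onD[OF exp_convex, of z 0 "- y"] assms by auto
  then show ?thesis by (simp add: algebra_simps)
qed

lemma sum_split_weights:
  assumes "n \<ge> 1"
  shows "(\<Sum>p\<in>{1..n}. 4 * (real p / (real n + 1)) * (1 - real p / (real n + 1))) \<ge> 2 / 3 * n"
proof -
  have *: "(\<Sum>p\<in>{1..n}. p * (c - real p)) = c * n * (real n + 1) / 2 - n * (real n + 1) * (2 * real n + 1) / 6" for c :: real
    by (induction n) (auto simp: field_simps)
  have "(\<Sum>p\<in>{1..n}. 4 * (real p / (real n + 1)) * (1 - real p / (real n + 1))) =
        (\<Sum>p\<in>{1..n}. 4 / (real n + 1)\<^sup>2 * (p * (real n + 1 - real p)))"
    by (intro sum.cong) (auto simp: field_simps power2_eq_square)
  also have "\<dots> = 4 / (real n + 1)\<^sup>2 * (n * (real n + 1) * (real n + 2) / 6)"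
    unfolding sum_distrib_left[symmetric] * by (simp add: field_simps)
  also have "\<dots> = 2 / 3 * n * ((real n + 2) / (real n + 1))"
    by (simp add: divide_simps) (simp add: power2_eq_square algebra_simps)
  also have "\<dots> \<ge> 2 / 3 * n * 1"
    by (intro mult_left_mono) auto
  finally show ?thesis by simp
qed

lemma exp_le_quadratic:
  fixes x :: real
  assumes "\<bar>x\<bar> \<le> 1"
  shows "exp x \<le> 1 + x + x\<^sup>2"
proof (cases "x \<ge> 0")
  case True
  then show ?thesis using exp_bound[of x] assms by auto
next
  case False
  have "exp x = 1 / exp (- x)" by (simp add: exp_minus field_simps)
  also have "\<dots> \<le> 1 / (1 - x + x\<^sup>2 / 2)"
    using exp_lower_Taylor_quadratic[of "- x"] False by (intro divide_left_mono) (auto intro!: mult_pos_pos add_pos_nonneg)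
  also have "\<dots> \<le> 1 + x + x\<^sup>2"
  proof -
    have "(1 + x + x\<^sup>2) * (1 - x + x\<^sup>2 / 2) - 1 = x\<^sup>2 * (1 - x + x\<^sup>2) / 2"
      by (simp add: power2_eq_square field_simps)
    also have "\<dots> \<ge> 0" using False by (intro divide_nonneg_pos mult_nonneg_nonneg) auto
    finally have "1 \<le> (1 + x + x\<^sup>2) * (1 - x + x\<^sup>2 / 2)" by simp
    moreover have "1 - x + x\<^sup>2 / 2 > 0" using False by (intro add_pos_nonneg) auto
    ultimately show ?thesis by (simp add: divide_le_eq)
  qed
  finally show ?thesis .
qed

text \<open>
  The average required by the induction for the two-sided bound with constant 100, away from
  \<open>t = 0\<close>. The toll contributes at most \<open>exp s\<close>, and the remaining sum over pivots is geometric with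
  rate of order \<open>(exp (s / 2) - 1)\<^sup>2 / n\<close>; as \<open>(exp (s / 2) - 1)\<^sup>2\<close> is comparable to \<open>exp s\<close> once
  \<open>s \<ge> 1/3\<close>, the constant 100 suffices.
\<close>
lemma two_sided_split_sum_large:
  fixes s t :: real
  assumes n: "n \<ge> 1" and s: "s = \<bar>t\<bar>" "s \<ge> 1/3"
  shows "(\<Sum>p\<in>{1..n}. exp (t * split_toll n p
            - 200 * min (p / (real n + 1)) (1 - p / (real n + 1)) * (exp (s / 2) - 1)\<^sup>2)) \<le> n"
proof -
  define E where "E = (exp (s / 2) - 1)\<^sup>2"
  define y where "y = 200 * E / (real n + 1)"
  have half: "exp (s / 2) \<ge> 7 / 6" using s exp_ge_add_one_self[of "s / 2"] by linarith
  have "exp (s / 2) - 1 \<ge> exp (s / 2) / 7" using half by simp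
  then have "(exp (s / 2) - 1)\<^sup>2 \<ge> (exp (s / 2) / 7)\<^sup>2" by (intro power_mono) auto
  then have E: "49 * E \<ge> exp s" unfolding E_def by (simp add: power_divide power2_eq_square flip: exp_add)
  then have Epos: "E > 0" using exp_gt_zero[of s] by linarith
  then have y: "y > 0" by (simp add: y_def)
  have "(\<Sum>p\<in>{1..n}. exp (t * split_toll n p - 200 * min (p / (real n + 1)) (1 - p / (real n + 1)) * E))
     \<le> (\<Sum>p\<in>{1..n}. exp s * exp (- y * min (real p) (real n + 1 - real p)))"
  proof (rule sum_mono)
    fix p assume p: "p \<in> {1..n}"
    have "t * split_toll n p \<le> \<bar>t * split_toll n p\<bar>" by simp
    also have "\<dots> \<le> s * 1" unfolding abs_mult s(1) using p abs_split_toll_le_1[of p n] by (intro mult_left_mono) auto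
    finally have "t * split_toll n p \<le> s" by simp
    moreover have "1 - p / (real n + 1) = (real n + 1 - p) / (real n + 1)" by (simp add: field_simps)
    then have "min (p / (real n + 1)) (1 - p / (real n + 1)) = min (real p) (real n + 1 - real p) / (real n + 1)"
      by (simp add: min_divide_distrib_right)
    then have "200 * min (p / (real n + 1)) (1 - p / (real n + 1)) * E = y * min (real p) (real n + 1 - real p)"
      by (simp add: y_def)
    ultimately show "exp (t * split_toll n p - 200 * min (p / (real n + 1)) (1 - p / (real n + 1)) * E)
       \<le> exp s * exp (- y * min (real p) (real n + 1 - real p))"
      by (simp flip: exp_add)
  qed
  also have "\<dots> \<le> exp s * (2 / y)"
    unfolding sum_distrib_left[symmetric] using sum_exp_min_le[OF y, of n] by (intro mult_left_mono) auto
  also have "\<dots> = (exp s / (100 * E)) * (real n + 1)" using Epos by (simp add: y_def field_simps)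
  also have "\<dots> \<le> (1 / 2) * (real n + 1)"
    using E Epos by (intro mult_right_mono) (auto simp: field_simps)
  also have "\<dots> \<le> n" using n by simp
  finally show ?thesis by (simp add: E_def)
qed

text \<open>
  The same average near \<open>t = 0\<close>. Here the fluctuation of the toll must be beaten to second order:
  its mean vanishes, so it contributes at most \<open>s\<^sup>2\<close> on average, while the subtracted term gains
  at least as much.
\<close>
lemma two_sided_split_sum_small:
  fixes s t :: real
  assumes n: "n \<ge> 1" and s: "s = \<bar>t\<bar>" "s \<le> 1/3"
  shows "(\<Sum>p\<in>{1..n}. exp (t * split_toll n p
            - 200 * min (p / (real n + 1)) (1 - p / (real n + 1)) * (exp (s / 2) - 1)\<^sup>2)) \<le> n"
proof -
  define a where "a p = p / (real n + 1)" for p :: nat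
  \<comment> \<open>The value of the subtracted term, after its reduction below, at the balanced split.\<close>
  define y where "y = 25/2 * s\<^sup>2"
  have s0: "s \<ge> 0" using s by simp
  have st: "s\<^sup>2 = t\<^sup>2" using s by simp
  have y0: "y \<ge> 0" by (simp add: y_def)
  have ey: "1 - exp (- y) \<ge> 9 / 2 * s\<^sup>2"
  proof -
    have "s\<^sup>2 \<le> (1/3)\<^sup>2" using s0 s by (intro power_mono) auto
    then have y1: "y \<le> 25/18" by (simp add: y_def power2_eq_square)
    have "exp (- y) = 1 / exp y" by (simp add: exp_minus field_simps)
    also have "\<dots> \<le> 1 / (1 + y)" using y0 exp_ge_add_one_self[of y] by (intro divide_left_mono) auto
    finally have "1 - exp (- y) \<ge> 1 - 1 / (1 + y)" by simp
    also have "1 - 1 / (1 + y) = y / (1 + y)" using y0 by (simp add: field_simps)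
    also have "y / (1 + y) \<ge> y / (1 + 25/18)" using y0 y1 by (intro divide_left_mono) auto
    finally have "1 - exp (- y) \<ge> y * (18 / 43)" by simp
    moreover have "y * (18/43) \<ge> 9 / 2 * s\<^sup>2" by (simp add: y_def)
    ultimately show ?thesis by linarith
  qed
  have half: "(exp (s / 2) - 1)\<^sup>2 \<ge> (s / 2)\<^sup>2"
    using s0 exp_ge_add_one_self[of "s / 2"] by (intro power_mono) linarith+
  have step: "exp (t * split_toll n p - 200 * min (a p) (1 - a p) * (exp (s / 2) - 1)\<^sup>2)
     \<le> 1 + t * split_toll n p + s\<^sup>2 - 1/3 * (4 * a p * (1 - a p)) * (1 - exp (- y))" if p: "p \<in> {1..n}" for p
  proof -
    define x where "x = t * split_toll n p"
    define z where "z = 4 * a p * (1 - a p)"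
    have a01: "0 \<le> a p" "a p \<le> 1" using p by (auto simp: a_def)
    have "(2 * a p - 1)\<^sup>2 = 1 - z" by (simp add: z_def power2_eq_square algebra_simps)
    then have z: "0 \<le> z" "z \<le> 1"
      using a01 zero_le_power2[of "2 * a p - 1"] by (auto simp: z_def)
    \<comment> \<open>The subtracted term is replaced by a multiple of \<open>a (1 - a)\<close>, whose average over the pivots is explicit.\<close>
    have "\<bar>x\<bar> \<le> s * 1" unfolding abs_mult s(1) x_def using p abs_split_toll_le_1[of p n] by (intro mult_left_mono) auto
    then have x: "\<bar>x\<bar> \<le> s" by simp
    have xe: "exp x \<le> 1 + x + x\<^sup>2" using x s by (intro exp_le_quadratic) auto
    have x2: "x\<^sup>2 \<le> s\<^sup>2" using x s0 by (simp add: abs_le_square_iff[symmetric])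
    have ex3: "exp x \<ge> 1 / 3"
      using exp_ge_add_one_self[of x] x s by linarith
    have "a p * (1 - a p) \<le> min (a p) (1 - a p)"
      using a01 mult_left_mono[of "1 - a p" 1 "a p"] mult_right_mono[of "a p" 1 "1 - a p"] by (auto simp: min_def)
    then have "(a p * (1 - a p)) * (50 * s\<^sup>2) \<le> min (a p) (1 - a p) * (50 * s\<^sup>2)"
      by (intro mult_right_mono) auto
    moreover have "y * z = (a p * (1 - a p)) * (50 * s\<^sup>2)" by (simp add: y_def z_def)
    ultimately have "y * z \<le> 200 * min (a p) (1 - a p) * (s / 2)\<^sup>2"
      by (simp add: power_divide mult_ac)
    also have "\<dots> \<le> 200 * min (a p) (1 - a p) * (exp (s / 2) - 1)\<^sup>2"
      using half a01 by (intro mult_left_mono) auto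
    finally have "exp (x - 200 * min (a p) (1 - a p) * (exp (s / 2) - 1)\<^sup>2) \<le> exp (x - y * z)" by simp
    also have "\<dots> = exp x - exp x * (1 - exp (- (y * z)))"
      by (simp add: algebra_simps flip: exp_add)
    also have "\<dots> \<le> exp x - 1/3 * (z * (1 - exp (- y)))"
      using one_minus_exp_concave[OF z, of y] ex3 z y0
      by (intro diff_left_mono mult_mono) (auto intro!: mult_nonneg_nonneg)
    finally show ?thesis using xe x2 by (simp add: x_def z_def)
  qed
  have "(\<Sum>p\<in>{1..n}. exp (t * split_toll n p - 200 * min (a p) (1 - a p) * (exp (s / 2) - 1)\<^sup>2))
     \<le> (\<Sum>p\<in>{1..n}. 1 + t * split_toll n p + s\<^sup>2 - 1/3 * (4 * a p * (1 - a p)) * (1 - exp (- y)))"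
    by (intro sum_mono step)
  also have "\<dots> = n + t * (\<Sum>p\<in>{1..n}. split_toll n p) + n * s\<^sup>2
      - 1/3 * (1 - exp (- y)) * (\<Sum>p\<in>{1..n}. 4 * a p * (1 - a p))"
    by (simp add: sum.distrib sum_subtractf sum_distrib_left sum_distrib_right mult_ac)
  also have "\<dots> \<le> n + n * s\<^sup>2 - 1/3 * (9 / 2 * s\<^sup>2) * (2 / 3 * n)"
  proof -
    have "1/3 * (1 - exp (- y)) * (\<Sum>p\<in>{1..n}. 4 * a p * (1 - a p)) \<ge> 1/3 * (9 / 2 * s\<^sup>2) * (2 / 3 * n)"
      using sum_split_weights[OF n] ey y0 unfolding a_def by (intro mult_mono) auto
    then show ?thesis unfolding sum_split_toll by simp
  qed
  also have "\<dots> = n" by simp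
  finally show ?thesis by (simp add: a_def)
qed

text \<open>
  The choice \<open>A a = 100 (exp (a |t|) - 1)\<close> makes the excess \<open>A a + A (1 - a) - A 1\<close> equal to the negative
  product \<open>- 100 (exp (a |t|) - 1) (exp ((1 - a) |t|) - 1)\<close>. The double exponential growth in \<open>t\<close> is
  the one that corresponds to a tail \<open>exp (- x ln x + O(x))\<close>. The bound also holds at \<open>t < 0\<close>, where it is
  far from sharp for large \<open>- t\<close> but controls the left tail for bounded \<open>t\<close> and gives tightness.
\<close>
lemma qs_mgf_le_exp_exp: "qs_mgf n t \<le> exp (100 * (exp \<bar>t\<bar> - 1))"
proof (induction n arbitrary: t rule: less_induct)
  case (less n)
  show ?case
  proof (cases "n = 0")
    case True
    then show ?thesis by (simp add: qs_mgf_0)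
  next
    case False
    then have n: "n \<ge> 1" by simp
    define A where "A a = 100 * (exp (a * \<bar>t\<bar>) - 1)" for a :: real
    have "qs_mgf n t \<le> exp (A 1)"
    proof (rule qs_mgf_induct_bound[OF n, where A = A])
      fix p assume p: "p \<in> {1..n}"
      then have a: "0 \<le> p / (real n + 1)" "0 \<le> 1 - p / (real n + 1)" by auto
      show "qs_mgf (p - 1) (p / (real n + 1) * t) \<le> exp (A (p / (real n + 1)))"
        using less[of "p - 1" "p / (real n + 1) * t"] p a unfolding A_def by (auto simp: abs_mult)
      show "qs_mgf (n - p) ((1 - p / (real n + 1)) * t) \<le> exp (A (1 - p / (real n + 1)))"
        using less[of "n - p" "(1 - p / (real n + 1)) * t"] p a(2) unfolding A_def abs_mult by auto
    next
      have "(\<Sum>p\<in>{1..n}. exp (t * split_toll n p + A (p / (real n + 1)) + A (1 - p / (real n + 1)) - A 1))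
        \<le> (\<Sum>p\<in>{1..n}. exp (t * split_toll n p
            - 200 * min (p / (real n + 1)) (1 - p / (real n + 1)) * (exp (\<bar>t\<bar> / 2) - 1)\<^sup>2))"
      proof (intro sum_mono)
        fix p assume p: "p \<in> {1..n}"
        define a where "a = p / (real n + 1)"
        have a: "0 \<le> a" "a \<le> 1" using p by (auto simp: a_def)
        have "exp (a * \<bar>t\<bar>) * exp ((1 - a) * \<bar>t\<bar>) = exp \<bar>t\<bar>"
          by (simp add: algebra_simps flip: exp_add)
        then have "A a + A (1 - a) - A 1 = - (100 * ((exp (a * \<bar>t\<bar>) - 1) * (exp ((1 - a) * \<bar>t\<bar>) - 1)))"
          unfolding A_def by (simp add: algebra_simps)
        then show "exp (t * split_toll n p + A (p / (real n + 1)) + A (1 - p / (real n + 1)) - A 1)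
          \<le> exp (t * split_toll n p - 200 * min (p / (real n + 1)) (1 - p / (real n + 1)) * (exp (\<bar>t\<bar> / 2) - 1)\<^sup>2)"
          using exp_gap_product[OF a, of "\<bar>t\<bar>"] unfolding a_def[symmetric] by simp
      qed
      also have "\<dots> \<le> n"
        using two_sided_split_sum_large[OF n refl] two_sided_split_sum_small[OF n refl] by (cases "\<bar>t\<bar> \<le> 1/3") auto
      finally show "(\<Sum>p\<in>{1..n}. exp (t * split_toll n p + A (p / (real n + 1)) + A (1 - p / (real n + 1)) - A 1)) \<le> n" .
    qed
    then show ?thesis by (simp add: A_def)
  qed
qed

section \<open>The sharp exponential moment on the left\<close>

text \<open>
  The reciprocal of the constant \<open>\<gamma>\<close> in the left tail. It is the number \<open>\<kappa>\<close> for which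
  \<open>(2 - \<kappa>) h - 1\<close> has maximum 0, where \<open>h\<close> runs over the values of the binary entropy, with maximum \<open>ln 2\<close>.
\<close>
definition left_rate :: real where "left_rate = 2 - 1 / ln 2"

lemma left_rate_bounds: "1 / 2 \<le> left_rate" "left_rate \<le> 1"
proof -
  have "1 / ln 2 \<le> 1 / (2 / 3 :: real)" using ln2_ge_two_thirds by (intro divide_left_mono) auto
  then show "1 / 2 \<le> left_rate" by (simp add: left_rate_def)
  show "left_rate \<le> 1" using ln_2_less_1 by (simp add: left_rate_def field_simps)
qed

lemma neg_split_toll_le:
  assumes "1 \<le> p" "p \<le> n"
  shows "- split_toll n p - left_rate * binary_entropy (p / (real n + 1))
    \<le> - (2 * (p / (real n + 1)) - 1)\<^sup>2 / 4"
proof -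
  define h where "h = binary_entropy (p / (real n + 1))"
  define z where "z = (2 * (p / (real n + 1)) - 1)\<^sup>2"
  have h: "h \<le> ln 2 - z / 4" unfolding h_def z_def using assms by (intro binary_entropy_le_ln2) auto
  have "- split_toll n p - left_rate * h \<le> h / ln 2 - 1"
    using split_toll_entropy(1)[OF assms] by (simp add: h_def left_rate_def left_diff_distrib)
  also have "\<dots> \<le> (ln 2 - z / 4) / ln 2 - 1"
    using h by (intro diff_right_mono divide_right_mono) auto
  also have "\<dots> = - (z / 4) / ln 2" by (simp add: field_simps)
  also have "\<dots> \<le> - (z / 4)" 
    using ln_2_less_1 mult_left_mono[of "ln 2" 1 z] by (simp add: z_def field_simps)
  finally show ?thesis by (simp add: h_def z_def)
qed

text \<open>
  The chain rule of entropy. It says that in the function \<open>\<kappa> t ln t\<close> a split at the fraction \<open>p / N\<close>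
  loses \<open>\<kappa> t\<close> times the entropy of the split.
\<close>
lemma split_log_entropy:
  assumes "0 < p" "p < N" "t > 0"
  shows "p / N * t * ln (p / N * t) + (1 - p / N) * t * ln ((1 - p / N) * t)
       = t * ln t - t * binary_entropy (p / N)"
proof -
  have a: "0 < p / N" "0 < 1 - p / N" using assms by auto
  show ?thesis unfolding ln_mult_pos[OF a(1) assms(3)] ln_mult_pos[OF a(2) assms(3)] binary_entropy_def
    by (simp add: algebra_simps)
qed

text \<open>
  A deterministic bound, sharp when all splits are balanced. It replaces the averaging argument when
  \<open>n < t\<close>: for small \<open>n\<close> there are too few pivots for the average over unbalanced splits to help.
\<close>
lemma qs_dev_lower:
  assumes "x \<in> set_pmf (quicksort_comparisons n)"
  shows "- qs_dev n x \<le> left_rate * ln (real n + 1)"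
  using assms
proof (induction n arbitrary: x rule: less_induct)
  case (less n)
  show ?case
  proof (cases "n = 0")
    case True
    with less.prems show ?thesis
      by (simp add: qs_dev_def quicksort_mean_0 quicksort_comparisons.simps)
  next
    case False
    with less.prems obtain p y z where p: "1 \<le> p" "p \<le> n"
      and y: "y \<in> set_pmf (quicksort_comparisons (p - 1))"
      and z: "z \<in> set_pmf (quicksort_comparisons (n - p))"
      and x: "x = y + z + (n - 1)"
      by (subst (asm) quicksort_comparisons.simps) (auto simp: set_pmf_of_set)
    define N where "N = real n + 1"
    have N: "0 < real p" "real p < N" "N > 0" "real (p - 1) + 1 = real p" "real (n - p) + 1 = N - p"
      using p by (auto simp: N_def)
    have 1: "- qs_dev (p - 1) y \<le> left_rate * ln p"
      using less.IH[OF _ y] p N(4) by auto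
    have 2: "- qs_dev (n - p) z \<le> left_rate * ln (N - p)"
    proof -
      have "n - p < n" using p by simp
      from less.IH[OF this z] show ?thesis unfolding N(5) .
    qed
    have "- qs_dev n x = p / N * (- qs_dev (p - 1) y) + (1 - p / N) * (- qs_dev (n - p) z) - split_toll n p"
      unfolding x using qs_dev_split[OF p] by (simp add: N_def algebra_simps)
    also have "\<dots> \<le> p / N * (left_rate * ln p) + (1 - p / N) * (left_rate * ln (N - p)) - split_toll n p"
      using 1 2 N by (intro diff_right_mono add_mono mult_left_mono) auto
    also have "p / N * (left_rate * ln p) + (1 - p / N) * (left_rate * ln (N - p)) =
        left_rate * (ln N - binary_entropy (p / N))"
    proof -
      define a where "a = p / N"
      have a: "0 < a" "0 < 1 - a" using N by (simp_all add: a_def)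
      have p_eq: "p = a * N" using N by (simp add: a_def)
      have "N - p = (1 - a) * N" by (simp add: p_eq left_diff_distrib)
      then have "ln p = ln a + ln N" "ln (N - p) = ln (1 - a) + ln N"
        using ln_mult_pos[OF a(1) N(3)] ln_mult_pos[OF a(2) N(3)] by (simp_all only: p_eq)
      then show ?thesis unfolding a_def[symmetric] by (simp add: binary_entropy_def algebra_simps)
    qed
    also have "left_rate * (ln N - binary_entropy (p / N)) - split_toll n p \<le> left_rate * ln N"
    proof -
      have "(2 * (p / N) - 1)\<^sup>2 \<ge> 0" by simp
      then have "- split_toll n p - left_rate * binary_entropy (p / N) \<le> 0"
        using neg_split_toll_le[OF p] unfolding N_def[symmetric] by linarith
      then show ?thesis by (simp only: right_diff_distrib)
    qed
    finally show ?thesis by (simp add: N_def)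
  qed
qed

lemma card_nat_interval:
  fixes a b :: real
  assumes "0 \<le> a" "a \<le> b"
  shows "finite {p::nat. a \<le> real p \<and> real p \<le> b}"
    and "real (card {p::nat. a \<le> real p \<and> real p \<le> b}) \<le> b - a + 1"
    and "b - a - 1 \<le> real (card {p::nat. a \<le> real p \<and> real p \<le> b})"
proof -
  have eq: "{p::nat. a \<le> real p \<and> real p \<le> b} = {nat \<lceil>a\<rceil>..nat \<lfloor>b\<rfloor>}"
    using assms by (auto simp: le_nat_iff le_floor_iff nat_le_iff ceiling_le_iff)
  show "finite {p::nat. a \<le> real p \<and> real p \<le> b}" by (simp add: eq)
  have "real (nat \<lfloor>b\<rfloor>) \<le> b" "b - 1 \<le> real (nat \<lfloor>b\<rfloor>)" "real (nat \<lceil>a\<rceil>) \<ge> a" "real (nat \<lceil>a\<rceil>) \<le> a + 1"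
    using assms by linarith+
  moreover have "nat \<lceil>a\<rceil> \<le> Suc (nat \<lfloor>b\<rfloor>)" using assms by linarith
  ultimately show "real (card {p::nat. a \<le> real p \<and> real p \<le> b}) \<le> b - a + 1"
    and "b - a - 1 \<le> real (card {p::nat. a \<le> real p \<and> real p \<le> b})"
    unfolding eq card_atLeastAtMost of_nat_diff[OF \<open>nat \<lceil>a\<rceil> \<le> Suc (nat \<lfloor>b\<rfloor>)\<close>] of_nat_Suc
    by linarith+ 
qed

text \<open>
  Only a small proportion of all pivots gives a nearly balanced split, and on all others the
  exponent is very negative for large \<open>t\<close>. The constants are chosen so that the sum over both kinds
  falls below \<open>n\<close> in spite of the additional factor \<open>exp 1\<close>.
\<close>
lemma balanced_split_sum:
  fixes t :: real
  assumes t: "t \<ge> 1024" "t \<le> n"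
  shows "(\<Sum>p\<in>{1..n}. exp (1 - t * (2 * (real p / (real n + 1)) - 1)\<^sup>2 / 4)) \<le> n"
proof -
  define N where "N = real n + 1"
  define W where "W = {p::nat. N / 2 - N / 16 \<le> real p \<and> real p \<le> N / 2 + N / 16}"
  have N: "N > 0" by (simp add: N_def)
  have W: "finite W" "card W \<le> N / 8 + 1"
    unfolding W_def using card_nat_interval[of "N / 2 - N / 16" "N / 2 + N / 16"] N by auto
  have e: "exp (1::real) \<le> 3" by (rule exp_le)
  have e4: "exp (- 4 :: real) \<le> 1 / 5"
  proof -
    have "exp (- 4 :: real) = 1 / exp 4" by (simp add: exp_minus field_simps)
    also have "\<dots> \<le> 1 / 5" using exp_ge_add_one_self[of 4] by (intro divide_left_mono) auto
    finally show ?thesis .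
  qed
  have "(\<Sum>p\<in>{1..n}. exp (1 - t * (2 * (real p / N) - 1)\<^sup>2 / 4)) \<le>
        (\<Sum>p\<in>{1..n}. 3 * (if p \<in> W then 1 else 0) + 3 / 5)"
  proof (rule sum_mono)
    fix p assume p: "p \<in> {1..n}"
    define z where "z = \<bar>2 * (real p / N) - 1\<bar>"
    have eq: "exp (1 - t * (2 * (real p / N) - 1)\<^sup>2 / 4) = exp 1 * exp (- (t * z\<^sup>2 / 4))"
      by (simp add: z_def flip: exp_add)
    show "exp (1 - t * (2 * (real p / N) - 1)\<^sup>2 / 4) \<le> 3 * (if p \<in> W then 1 else 0) + 3 / 5"
    proof (cases "p \<in> W")
      case True
      have "exp 1 * exp (- (t * z\<^sup>2 / 4)) \<le> 3 * 1" using t e by (intro mult_mono) auto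
      with True show ?thesis unfolding eq by auto
    next
      case False
      then have "z \<ge> 1 / 8" using N unfolding W_def z_def by (auto simp: field_simps abs_if)
      then have "z\<^sup>2 \<ge> (1/8)\<^sup>2" by (intro power_mono) auto
      then have "t * z\<^sup>2 \<ge> 1024 * (1/64)" using t by (intro mult_mono) (auto simp: power2_eq_square)
      then have "exp (- (t * z\<^sup>2 / 4)) \<le> exp (- 4)" by simp
      also note e4
      finally have "exp 1 * exp (- (t * z\<^sup>2 / 4)) \<le> 3 * (1/5)" using e by (intro mult_mono) auto
      with False show ?thesis unfolding eq by auto
    qed
  qed
  also have "\<dots> = 3 * card ({1..n} \<inter> W) + 3 / 5 * n"
    by (simp add: sum.distrib sum.If_cases flip: sum_distrib_left)
  also have "\<dots> \<le> 3 * (N / 8 + 1) + 3 / 5 * n"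
    using W card_mono[of W "{1..n} \<inter> W"] by auto
  also have "\<dots> \<le> n"
  proof -
    have "3 * ((x + 1) / 8 + 1) + 3 / 5 * x \<le> x" if "x \<ge> 1024" for x :: real
      using that by (simp add: field_simps)
    from this[of "real n"] t show ?thesis by (simp add: N_def)
  qed
  finally show ?thesis by (simp add: N_def)
qed

text \<open>
  The additive 1 in the exponent is there for small \<open>t\<close>, where \<open>t ln t\<close> is negative. In an induction
  step the two subproblems contribute it twice; the surplus is the factor \<open>exp 1\<close> that the average
  over pivots has to absorb.
\<close>
lemma qs_mgf_left:
  obtains c where "c \<ge> 0" "\<And>n t. t > 0 \<Longrightarrow> qs_mgf n (- t) \<le> exp (left_rate * (t * ln t) + c * t + 1)"
proof
  \<comment> \<open>Large enough for \<open>100 (exp t - 1) \<le> c t\<close> on the interval up to 1024.\<close>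
  define c :: real where "c = 100 * exp 1024"
  have c1: "c \<ge> 1" using exp_ge_add_one_self[of 1024] by (simp add: c_def)
  show "c \<ge> 0" using c1 by simp
  have xlnx: "left_rate * (t * ln t) + 1 \<ge> 0" if "t > 0" for t
  proof -
    have "ln (1 / t) \<le> 1 / t - 1" using that by (intro ln_le_minus_one) auto
    then have "t * ln t \<ge> t * (1 - 1 / t)" using that by (intro mult_left_mono) (auto simp: ln_div)
    also have "t * (1 - 1 / t) \<ge> - 1" using that by (simp add: algebra_simps)
    finally have "left_rate * (t * ln t) \<ge> left_rate * (- 1)" 
      using left_rate_bounds by (intro mult_left_mono) auto
    then show ?thesis using left_rate_bounds by simp
  qed
  fix n :: nat and t :: real assume "t > 0"
  then show "qs_mgf n (- t) \<le> exp (left_rate * (t * ln t) + c * t + 1)"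
  proof (induction n arbitrary: t rule: less_induct)
    case (less n)
    \<comment> \<open>The two-sided bound serves for bounded \<open>t\<close>, the deterministic bound for large \<open>t\<close> and
      small \<open>n\<close>; only the last case uses the induction hypothesis.\<close>
    consider "t \<le> 1024" | "t \<ge> 1024" "n < t" | "t \<ge> 1024" "t \<le> n" by linarith
    then show ?case
    proof cases
      case 1
      have "1 + (- t) \<le> exp (- t)" by (rule exp_ge_add_one_self)
      then have "exp t * (1 + (- t)) \<le> exp t * exp (- t)" by (intro mult_left_mono) auto
      then have "exp t - 1 \<le> t * exp t" by (simp add: algebra_simps flip: exp_add)
      also have "\<dots> \<le> t * exp 1024" using 1 less.prems by (intro mult_left_mono) auto
      finally have "exp t - 1 \<le> t * exp 1024" .
      then have "100 * (exp \<bar>- t\<bar> - 1) \<le> 100 * (t * exp 1024)"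
        using less.prems by (intro mult_left_mono) auto
      also have "\<dots> = c * t" unfolding c_def by (simp only: mult_ac)
      finally have "100 * (exp \<bar>- t\<bar> - 1) \<le> c * t" .
      with xlnx[OF less.prems] have "100 * (exp \<bar>- t\<bar> - 1) \<le> left_rate * (t * ln t) + c * t + 1" by linarith
      with qs_mgf_le_exp_exp[of n "- t"] show ?thesis by (meson exp_le_cancel_iff order_trans)
    next
      case 2
      have "qs_mgf n (- t) \<le> measure_pmf.expectation (quicksort_comparisons n) (\<lambda>x. exp (left_rate * (t * ln t) + c * t + 1))"
        unfolding qs_mgf_def
      proof (rule integral_mono_AE)
        show "AE x in measure_pmf (quicksort_comparisons n). exp (- t * qs_dev n x) \<le> exp (left_rate * (t * ln t) + c * t + 1)"
        proof (rule AE_pmfI)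
          fix x assume x: "x \<in> set_pmf (quicksort_comparisons n)"
          have "ln (real n + 1) \<le> ln (2 * t)" using 2 by simp
          also have "\<dots> = ln 2 + ln t" using 2 by (simp add: ln_mult)
          also have "\<dots> \<le> 1 + ln t" using ln_2_less_1 by simp
          finally have "left_rate * ln (real n + 1) \<le> left_rate * (1 + ln t)"
            using left_rate_bounds by (intro mult_left_mono) auto
          also have "\<dots> \<le> left_rate * ln t + c" using left_rate_bounds c1 by (simp add: algebra_simps)
          finally have "- qs_dev n x \<le> left_rate * ln t + c" using qs_dev_lower[OF x] by simp
          then have "t * (- qs_dev n x) \<le> t * (left_rate * ln t + c)" using 2 by (intro mult_left_mono) auto
          then show "exp (- t * qs_dev n x) \<le> exp (left_rate * (t * ln t) + c * t + 1)"
            by (simp add: algebra_simps)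
        qed
      qed simp_all
      then show ?thesis by simp
    next
      case 3
      define A where "A a = left_rate * ((a * t) * ln (a * t)) + c * (a * t) + 1" for a
      have n: "n \<ge> 1" using 3 by linarith
      have "qs_mgf n (- t) \<le> exp (A 1)"
      proof (rule qs_mgf_induct_bound[OF n, where A = A])
        fix p assume p: "p \<in> {1..n}"
        then have a: "0 < p / (real n + 1)" "0 < 1 - p / (real n + 1)" by auto
        show "qs_mgf (p - 1) (p / (real n + 1) * - t) \<le> exp (A (p / (real n + 1)))"
          using less.IH[of "p - 1" "p / (real n + 1) * t"] p a(1) less.prems unfolding A_def by auto
        show "qs_mgf (n - p) ((1 - p / (real n + 1)) * - t) \<le> exp (A (1 - p / (real n + 1)))"
          using less.IH[of "n - p" "(1 - p / (real n + 1)) * t"] p mult_pos_pos[OF a(2) less.prems] unfolding A_def by auto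
      next
        have "(\<Sum>p\<in>{1..n}. exp (- t * split_toll n p + A (p / (real n + 1)) + A (1 - p / (real n + 1)) - A 1))
          \<le> (\<Sum>p\<in>{1..n}. exp (1 - t * (2 * (real p / (real n + 1)) - 1)\<^sup>2 / 4))"
        proof (rule sum_mono)
          fix p assume p: "p \<in> {1..n}"
          define a where "a = p / (real n + 1)"
          have "a * t * ln (a * t) + (1 - a) * t * ln ((1 - a) * t) = t * ln t - t * binary_entropy a"
            unfolding a_def using p less.prems by (intro split_log_entropy) auto
          then have "left_rate * (a * t * ln (a * t) + (1 - a) * t * ln ((1 - a) * t)) = left_rate * (t * ln t - t * binary_entropy a)"
            by simp
          then have "A a + A (1 - a) - A 1 = 1 - left_rate * (t * binary_entropy a)"
            by (simp add: A_def algebra_simps)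
          moreover have "t * (- split_toll n p - left_rate * binary_entropy a) \<le> t * (- (2 * a - 1)\<^sup>2 / 4)"
            using neg_split_toll_le[of p n] p less.prems unfolding a_def by (intro mult_left_mono) auto
          ultimately show "exp (- t * split_toll n p + A (p / (real n + 1)) + A (1 - p / (real n + 1)) - A 1)
            \<le> exp (1 - t * (2 * (real p / (real n + 1)) - 1)\<^sup>2 / 4)"
            unfolding a_def[symmetric] by (simp add: algebra_simps)
        qed
        also have "\<dots> \<le> n" using balanced_split_sum 3 by auto
        finally show "(\<Sum>p\<in>{1..n}. exp (- t * split_toll n p + A (p / (real n + 1)) + A (1 - p / (real n + 1)) - A 1)) \<le> n" .
      qed
      then show ?thesis by (simp add: A_def)
    qed
  qed
qed

section \<open>Tail probabilities before the limit\<close>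

definition qs_prob :: "nat \<Rightarrow> (real \<Rightarrow> bool) \<Rightarrow> real" where
  "qs_prob n P = measure (measure_pmf (quicksort_comparisons n)) {x. P (qs_dev n x)}"

lemma qs_prob_mono:
  assumes "\<And>v. P v \<Longrightarrow> Q v"
  shows "qs_prob n P \<le> qs_prob n Q"
  unfolding qs_prob_def by (rule measure_pmf.finite_measure_mono) (use assms in auto)

lemma qs_prob_expectation:
  "qs_prob n P = measure_pmf.expectation (quicksort_comparisons n) (\<lambda>x. of_bool (P (qs_dev n x)))"
proof -
  have "(\<lambda>x. of_bool (P (qs_dev n x)) :: real) = indicator {x. P (qs_dev n x)}"
    by (auto simp: fun_eq_iff indicator_def)
  then show ?thesis by (simp add: qs_prob_def)
qed

lemma qs_prob_Markov:
  "qs_prob n (\<lambda>v. u \<le> t * v) \<le> exp (- u) * qs_mgf n t"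
proof -
  have "qs_prob n (\<lambda>v. u \<le> t * v)
      \<le> measure_pmf.expectation (quicksort_comparisons n) (\<lambda>x. exp (- u) * exp (t * qs_dev n x))"
    unfolding qs_prob_expectation
    by (rule integral_mono) (auto simp: of_bool_def simp flip: exp_add)
  then show ?thesis by (simp add: qs_mgf_def)
qed

text \<open>
  The probabilistic form of the recursion, for lower bounds: it suffices that the pivot lies in a
  prescribed set and that both subproblems behave in a prescribed way.
\<close>
lemma qs_prob_split:
  assumes n: "n \<ge> 1" and S: "S \<subseteq> {1..n}" and ab: "0 \<le> a" "0 \<le> b"
    and a: "\<And>p. p \<in> S \<Longrightarrow> a \<le> qs_prob (p - 1) P"
    and b: "\<And>p. p \<in> S \<Longrightarrow> b \<le> qs_prob (n - p) Q"
    and R: "\<And>p v w. p \<in> S \<Longrightarrow> P v \<Longrightarrow> Q w \<Longrightarrow>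
      R (real p / (real n + 1) * v + (1 - real p / (real n + 1)) * w + split_toll n p)"
  shows "card S / n * (a * b) \<le> qs_prob n R"
proof -
  define f where "f p = measure_pmf.expectation (quicksort_comparisons (p - 1)) (\<lambda>x.
       measure_pmf.expectation (quicksort_comparisons (n - p)) (\<lambda>y.
         of_bool (R (qs_dev n (x + y + (n - 1)))) :: real))" for p
  have f0: "f p \<ge> 0" for p
    unfolding f_def by (intro Bochner_Integration.integral_nonneg) auto
  have fS: "a * b \<le> f p" if p: "p \<in> S" for p
  proof -
    have "a * b \<le> qs_prob (p - 1) P * qs_prob (n - p) Q"
      using p by (intro mult_mono a b) (auto simp: ab qs_prob_def)
    also have "\<dots> = measure_pmf.expectation (quicksort_comparisons (p - 1)) (\<lambda>x.
       measure_pmf.expectation (quicksort_comparisons (n - p)) (\<lambda>y.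
         of_bool (P (qs_dev (p - 1) x)) * of_bool (Q (qs_dev (n - p) y))))"
      by (simp add: qs_prob_expectation)
    also have "\<dots> \<le> f p"
      unfolding f_def
    proof (intro integral_mono integrable_quicksort)
      fix x y
      have "qs_dev n (x + y + (n - 1)) = p / (real n + 1) * qs_dev (p - 1) x
          + (1 - p / (real n + 1)) * qs_dev (n - p) y + split_toll n p"
        using p S by (intro qs_dev_split) auto
      then show "of_bool (P (qs_dev (p - 1) x)) * of_bool (Q (qs_dev (n - p) y))
          \<le> (of_bool (R (qs_dev n (x + y + (n - 1)))) :: real)"
        using R[OF p] by auto
    qed
    finally show ?thesis .
  qed
  have "card S * (a * b) = (\<Sum>p\<in>S. a * b)" by simp
  also have "\<dots> \<le> (\<Sum>p\<in>S. f p)" by (intro sum_mono fS)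
  also have "\<dots> \<le> (\<Sum>p\<in>{1..n}. f p)" using S f0 by (intro sum_mono2) auto
  finally have "card S * (a * b) / n \<le> (\<Sum>p\<in>{1..n}. f p) / n" by (intro divide_right_mono) auto
  also have "\<dots> = qs_prob n R"
    unfolding qs_prob_expectation f_def by (subst quicksort_expectation_rec[OF n]) simp
  finally show ?thesis by (simp add: field_simps)
qed

lemma qs_prob_compl: "qs_prob n (\<lambda>v. \<not> P v) = 1 - qs_prob n P"
proof -
  have "{x. \<not> P (qs_dev n x)} = space (measure_pmf (quicksort_comparisons n)) - {x. P (qs_dev n x)}" by auto
  then show ?thesis
    using measure_pmf.prob_compl[of "{x. P (qs_dev n x)}" "quicksort_comparisons n"]
    by (simp add: qs_prob_def)
qed

lemma qs_prob_tight:
  obtains K where "K \<ge> 0" "\<And>n. qs_prob n (\<lambda>v. v \<le> K) \<ge> 1 / 2" "\<And>n. qs_prob n (\<lambda>v. - K \<le> v) \<ge> 1 / 2"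
proof
  define K :: real where "K = 100 * (exp 1 - 1) + 1"
  show "K \<ge> 0" unfolding K_def by (intro add_nonneg_nonneg mult_nonneg_nonneg) auto
  have half: "exp (- K) * qs_mgf n t \<le> 1 / 2" if "\<bar>t\<bar> = 1" for n t
  proof -
    have "exp (- K) * qs_mgf n t \<le> exp (- K) * exp (100 * (exp 1 - 1))"
      using qs_mgf_le_exp_exp[of n t] that by (intro mult_left_mono) auto
    also have "\<dots> = 1 / exp 1" by (simp add: K_def exp_minus field_simps flip: exp_add)
    also have "\<dots> \<le> 1 / 2" using exp_ge_add_one_self[of 1] by (intro divide_left_mono) auto
    finally show ?thesis .
  qed
  fix n
  have "qs_prob n (\<lambda>v. \<not> v \<le> K) \<le> qs_prob n (\<lambda>v. K \<le> 1 * v)" by (intro qs_prob_mono) auto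
  also have "\<dots> \<le> 1 / 2" using qs_prob_Markov[of n K 1] half[of 1 n] by simp
  finally show "qs_prob n (\<lambda>v. v \<le> K) \<ge> 1 / 2" unfolding qs_prob_compl by simp
  have "qs_prob n (\<lambda>v. \<not> - K \<le> v) \<le> qs_prob n (\<lambda>v. K \<le> - 1 * v)" by (intro qs_prob_mono) auto
  also have "\<dots> \<le> 1 / 2" using qs_prob_Markov[of n K "- 1"] half[of "- 1" n] by simp
  finally show "qs_prob n (\<lambda>v. - K \<le> v) \<ge> 1 / 2" unfolding qs_prob_compl by simp
qed

section \<open>Lower bounds on the tails before the limit\<close>

text \<open>
  A nearly balanced split, with both subproblems below \<open>v\<close>, puts the whole below \<open>v - (2 ln 2 - 1)\<close>
  up to \<open>O(\<delta>\<^sup>2)\<close>. Hence each gain of \<open>2 ln 2 - 1\<close> squares the probability and costs one factor of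
  order \<open>\<delta>\<close>. The prefactor \<open>2 / \<delta>\<close> is the one that makes the recursion \<open>s \<mapsto> (\<delta> / 2) s\<^sup>2\<close> a pure squaring.
\<close>
lemma qs_prob_left_lower:
  fixes \<delta> K :: real
  assumes K: "\<And>n. qs_prob n (\<lambda>v. v \<le> K) \<ge> 1 / 2" and d: "0 < \<delta>" "\<delta> \<le> 1 / 4"
  shows "\<exists>n0. \<forall>n\<ge>n0. 2 / \<delta> * (\<delta> / 4) ^ 2 ^ k
    \<le> qs_prob n (\<lambda>v. v \<le> K - k * (2 * ln 2 - 1 - 12 * \<delta>\<^sup>2))"
proof (induction k)
  case 0
  then show ?case using K d by auto
next
  case (Suc k)
  define L where "L = 2 * ln 2 - 1 - 12 * \<delta>\<^sup>2"
  define s where "s = 2 / \<delta> * (\<delta> / 4) ^ 2 ^ k"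
  from Suc obtain n0 where n0: "\<And>n. n \<ge> n0 \<Longrightarrow> s \<le> qs_prob n (\<lambda>v. v \<le> K - k * L)"
    unfolding L_def s_def by auto
  have s0: "s \<ge> 0" using d by (simp add: s_def)
  show ?case
  proof (intro exI allI impI)
    fix n assume n: "n \<ge> max (4 * n0 + 8) (nat \<lceil>4 / \<delta>\<^sup>2\<rceil>)"
    define N where "N = real n + 1"
    have n1: "real n \<ge> 4 / \<delta>\<^sup>2" "real n \<ge> 4 * real n0 + 8" "n \<ge> 1" using n by linarith+
    have N: "N > 0" by (simp add: N_def)
    define S where "S = {p::nat. N / 2 \<le> real p \<and> real p \<le> N / 2 + \<delta> * N}"
    have dN: "\<delta> * N \<le> N / 4" "\<delta> * N \<ge> 0" using d N mult_right_mono[of \<delta> "1/4" N] by auto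
    have p_bounds: "1 \<le> p" "p \<le> n" "n0 \<le> p - 1" "n0 \<le> n - p"
      "real p / N \<ge> 1 / 2" "real p / N \<le> 1 / 2 + \<delta>" if "p \<in> S" for p
    proof -
      have p: "N / 2 \<le> real p" "real p \<le> N / 2 + \<delta> * N" using that by (auto simp: S_def)
      have "real p \<ge> real n0 + 1" using p dN n1(2) N_def by linarith
      moreover have "real p + real n0 \<le> real n" using p dN n1(2) N_def by linarith
      ultimately show "1 \<le> p" "p \<le> n" "n0 \<le> p - 1" "n0 \<le> n - p" by linarith+
      show "real p / N \<ge> 1 / 2" "real p / N \<le> 1 / 2 + \<delta>" using p N by (auto simp: field_simps)
    qed
    have S: "S \<subseteq> {1..n}" using p_bounds by auto
    have dn: "\<delta> * real n \<ge> 4"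
    proof -
      have "\<delta> * real n \<ge> \<delta> * (4 / \<delta>\<^sup>2)" using n1(1) d by (intro mult_left_mono) auto
      also have "\<delta> * (4 / \<delta>\<^sup>2) = 4 / \<delta>" using d by (simp add: power2_eq_square)
      also have "\<dots> \<ge> 4 / 1" using d by (intro divide_left_mono) auto
      finally show ?thesis by simp
    qed
    have "\<delta> * N - 1 \<le> card S"
      unfolding S_def using card_nat_interval(3)[of "N / 2" "N / 2 + \<delta> * N"] N dN by simp
    moreover have "\<delta> * N = \<delta> * real n + \<delta>" by (simp add: N_def algebra_simps)
    ultimately have card: "\<delta> / 2 * real n \<le> card S" using dn d by linarith
    have "card S / n * (s * s) \<le> qs_prob n (\<lambda>v. v \<le> K - Suc k * L)"
    proof (rule qs_prob_split[OF n1(3) S s0 s0])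
      fix p assume p: "p \<in> S"
      show "s \<le> qs_prob (p - 1) (\<lambda>v. v \<le> K - k * L)" "s \<le> qs_prob (n - p) (\<lambda>v. v \<le> K - k * L)"
        using p_bounds[OF p] by (auto intro: n0)
      fix v w assume vw: "v \<le> K - k * L" "w \<le> K - k * L"
      define a where "a = real p / N"
      have a: "1 / 2 \<le> a" "a \<le> 1 / 2 + \<delta>" using p_bounds[OF p] by (auto simp: a_def)
      have "(2 * a - 1)\<^sup>2 \<le> (2 * \<delta>)\<^sup>2" using a by (intro power_mono) auto
      then have "binary_entropy a \<ge> ln 2 - 4 * \<delta>\<^sup>2" using binary_entropy_ge_ln2[of a] a d by (simp add: power_mult_distrib)
      moreover have "4 / N \<le> \<delta>\<^sup>2" 
      proof -
        have "4 \<le> real n * \<delta>\<^sup>2" using n1(1) d by (simp add: field_simps)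
        also have "\<dots> \<le> N * \<delta>\<^sup>2" by (intro mult_right_mono) (auto simp: N_def)
        finally show ?thesis using N by (simp add: field_simps)
      qed
      moreover have "split_toll n p \<le> 1 - 2 * binary_entropy a + 4 / N"
        using split_toll_entropy(2)[of p n] p_bounds[OF p] by (simp add: a_def N_def)
      moreover have "\<delta>\<^sup>2 \<ge> 0" by simp
      ultimately have toll: "split_toll n p \<le> - L" unfolding L_def by linarith
      have "a * v + (1 - a) * w \<le> a * (K - k * L) + (1 - a) * (K - k * L)"
        using a d vw by (intro add_mono mult_left_mono) auto
      also have "\<dots> = K - k * L" by (simp add: algebra_simps)
      finally have "a * v + (1 - a) * w + split_toll n p \<le> K - k * L - L" using toll by linarith
      then show "real p / (real n + 1) * v + (1 - real p / (real n + 1)) * w + split_toll n p \<le> K - Suc k * L"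
        by (simp add: a_def N_def algebra_simps)
    qed
    moreover have "2 / \<delta> * (\<delta> / 4) ^ 2 ^ Suc k \<le> card S / n * (s * s)"
    proof -
      have "2 / \<delta> * (\<delta> / 4) ^ 2 ^ Suc k = \<delta> / 2 * (s * s)"
        using d by (simp add: s_def power_mult power2_eq_square mult.commute[of 2])
      also have "\<dots> \<le> card S / n * (s * s)"
        using card n1(3) by (intro mult_right_mono) (auto simp: field_simps)
      finally show ?thesis .
    qed
    ultimately show "2 / \<delta> * (\<delta> / 4) ^ 2 ^ Suc k \<le> qs_prob n (\<lambda>v. v \<le> K - Suc k * (2 * ln 2 - 1 - 12 * \<delta>\<^sup>2))"
      unfolding L_def by linarith
  qed
qed

lemma binary_entropy_small:
  fixes a \<delta> :: real
  assumes "0 < a" "a \<le> \<delta>" "\<delta> \<le> 1 / 4"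
  shows "binary_entropy a \<le> 2 * \<delta> - \<delta> * ln \<delta>"
proof -
  have "ln (\<delta> / a) \<le> \<delta> / a - 1" using assms by (intro ln_le_minus_one) auto
  then have "a * ln (\<delta> / a) \<le> a * (\<delta> / a - 1)" using assms by (intro mult_left_mono) auto
  also have "\<dots> \<le> \<delta>" using assms by (simp add: algebra_simps)
  finally have "- (a * ln a) \<le> \<delta> - a * ln \<delta>" using assms by (simp add: ln_div algebra_simps)
  moreover have "a * ln \<delta> \<ge> \<delta> * ln \<delta>" using assms by (intro mult_right_mono_neg) auto
  moreover have "- ((1 - a) * ln (1 - a)) \<le> \<delta>"
  proof -
    have "ln (1 / (1 - a)) \<le> 1 / (1 - a) - 1" using assms by (intro ln_le_minus_one) auto
    then have "(1 - a) * ln (1 / (1 - a)) \<le> (1 - a) * (1 / (1 - a) - 1)" using assms by (intro mult_left_mono) auto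
    also have "\<dots> = a" using assms by (simp add: field_simps)
    finally show ?thesis using assms by (simp add: ln_div)
  qed
  ultimately show ?thesis unfolding binary_entropy_def by linarith
qed

text \<open>
  If the pivot is among the smallest fraction \<open>\<delta>\<close>, the larger subproblem has almost full weight and
  the toll is nearly 1. So, as long as the smaller subproblem is not exceptionally low, the deviation
  grows by nearly 1 at the cost of one factor of order \<open>\<delta>\<close>. Stopping at the target \<open>X\<close> keeps the loss in
  each step, \<open>1 - L\<close>, uniformly bounded.
\<close>
lemma qs_prob_right_lower:
  fixes \<delta> K X L :: real
  assumes K: "K \<ge> 0" "\<And>n. qs_prob n (\<lambda>v. - K \<le> v) \<ge> 1 / 2" and d: "0 < \<delta>" "\<delta> \<le> 1 / 4"
    and X: "X \<ge> 0" and L: "L = 1 - (\<delta> * (X + 2 * K + 4) - 2 * \<delta> * ln \<delta>)" "L \<ge> 0"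
  shows "\<exists>n0. \<forall>n\<ge>n0. 1 / 2 * (\<delta> / 4) ^ k \<le> qs_prob n (\<lambda>v. min X (- K + k * L) \<le> v)"
proof (induction k)
  case 0
  have "1 / 2 * (\<delta> / 4) ^ 0 \<le> qs_prob n (\<lambda>v. min X (- K + real 0 * L) \<le> v)" for n
  proof -
    have "qs_prob n (\<lambda>v. - K \<le> v) \<le> qs_prob n (\<lambda>v. min X (- K + real 0 * L) \<le> v)"
      by (rule qs_prob_mono) auto
    with K(2)[of n] show ?thesis by simp
  qed
  then show ?case by blast
next
  case (Suc k)
  define y where "y = min X (- K + k * L)"
  define s where "s = 1 / 2 * (\<delta> / 4) ^ k"
  from Suc obtain n0 where n0: "\<And>n. n \<ge> n0 \<Longrightarrow> s \<le> qs_prob n (\<lambda>v. y \<le> v)"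
    unfolding y_def s_def by auto
  have s0: "s \<ge> 0" using d by (simp add: s_def)
  have "0 \<le> real k * L" using L(2) by simp
  then have y: "\<bar>y\<bar> \<le> X + K" using X K(1) unfolding y_def min_def abs_le_iff by auto
  show ?case
  proof (intro exI allI impI)
    fix n assume n: "n \<ge> max (2 * n0 + 2) (nat \<lceil>4 / \<delta>\<rceil>)"
    define N where "N = real n + 1"
    have n1: "real n \<ge> 4 / \<delta>" "real n \<ge> 2 * real n0 + 2" "n \<ge> 1" using n by linarith+
    have N: "N > 0" by (simp add: N_def)
    define S where "S = {p::nat. 1 \<le> real p \<and> real p \<le> \<delta> * N}"
    have dN: "\<delta> * N \<le> N / 4" "\<delta> * N \<ge> 0" using d N mult_right_mono[of \<delta> "1/4" N] by auto
    have p_bounds: "1 \<le> p" "p \<le> n" "n0 \<le> n - p" "0 < real p / N" "real p / N \<le> \<delta>" if "p \<in> S" for p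
    proof -
      have p: "1 \<le> real p" "real p \<le> \<delta> * N" using that by (auto simp: S_def)
      have "real p + real n0 \<le> real n" using p dN n1(2) N_def by linarith
      with p show "1 \<le> p" "p \<le> n" "n0 \<le> n - p" by linarith+
      show "0 < real p / N" "real p / N \<le> \<delta>" using p N by (auto simp: field_simps)
    qed
    have S: "S \<subseteq> {1..n}" using p_bounds by auto
    have dn: "\<delta> * real n \<ge> 4" using n1(1) d by (simp add: field_simps)
    have dN': "\<delta> * N = \<delta> * real n + \<delta>" by (simp add: N_def algebra_simps)
    have "\<delta> * N - 1 - 1 \<le> card S"
      unfolding S_def using card_nat_interval(3)[of 1 "\<delta> * N"] dN' dn d by simp
    then have card: "\<delta> / 2 * real n \<le> card S" using dn d dN' by linarith
    have "card S / n * (1 / 2 * s) \<le> qs_prob n (\<lambda>v. min X (- K + Suc k * L) \<le> v)"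
    proof (rule qs_prob_split[OF n1(3) S _ s0])
      show "(0::real) \<le> 1 / 2" by simp
      fix p assume p: "p \<in> S"
      show "1 / 2 \<le> qs_prob (p - 1) (\<lambda>v. - K \<le> v)" by (rule K)
      show "s \<le> qs_prob (n - p) (\<lambda>v. y \<le> v)"
        using p_bounds[OF p] by (auto intro: n0)
      fix v w assume vw: "- K \<le> v" "y \<le> w"
      define a where "a = real p / N"
      have a: "0 < a" "a \<le> \<delta>" using p_bounds[OF p] by (auto simp: a_def)
      have toll: "split_toll n p \<ge> 1 - 2 * (2 * \<delta> - \<delta> * ln \<delta>)"
        using binary_entropy_small[OF a d(2)] split_toll_entropy(1)[of p n] p_bounds[OF p]
        by (simp add: a_def N_def)
      have "a * v + (1 - a) * w \<ge> a * (- K) + (1 - a) * y"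
        using a d vw by (intro add_mono mult_left_mono) auto
      moreover have "a * y \<le> \<delta> * (X + K)"
      proof -
        have "a * y \<le> a * \<bar>y\<bar>" using a by (intro mult_left_mono) auto
        also have "\<dots> \<le> \<delta> * (X + K)" using a d y by (intro mult_mono) auto
        finally show ?thesis .
      qed
      moreover have "a * K \<le> \<delta> * K" using a K(1) by (intro mult_right_mono) auto
      ultimately have "a * v + (1 - a) * w \<ge> y - \<delta> * (X + 2 * K)" by (simp add: algebra_simps)
      with toll have "y + L \<le> a * v + (1 - a) * w + split_toll n p"
        unfolding L(1) by (simp add: algebra_simps)
      moreover have "min X (- K + Suc k * L) \<le> y + L" using L(2) by (auto simp: y_def min_def algebra_simps)
      ultimately show "min X (- K + Suc k * L) \<le>
          real p / (real n + 1) * v + (1 - real p / (real n + 1)) * w + split_toll n p"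
        unfolding a_def N_def by linarith
    qed
    moreover have "1 / 2 * (\<delta> / 4) ^ Suc k \<le> card S / n * (1 / 2 * s)"
    proof -
      have "1 / 2 * (\<delta> / 4) ^ Suc k = \<delta> / 2 * (1 / 2 * s)" by (simp add: s_def)
      also have "\<dots> \<le> card S / n * (1 / 2 * s)"
        using card n1(3) s0 by (intro mult_right_mono) (auto simp: field_simps)
      finally show ?thesis .
    qed
    ultimately show "1 / 2 * (\<delta> / 4) ^ Suc k \<le> qs_prob n (\<lambda>v. min X (- K + Suc k * L) \<le> v)" by linarith
  qed
qed

section \<open>Passage to the limit\<close>

text \<open>
  Weak convergence only speaks of continuity points of the limit, but every open interval contains
  one. Moving by a bounded amount inside such an interval changes the tails only within the stated
  error terms. The argument \<open>v (n + 1) / n\<close> changes the normalisation back from \<open>n + 1\<close> to \<open>n\<close>.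
\<close>
lemma limiting_quicksort_cdf:
  assumes "prob_space M" "Z \<in> borel_measurable M" "limiting_quicksort_distribution (distr M borel Z)" "a < b"
  obtains c where "a < c" "c < b"
    "(\<lambda>n. qs_prob n (\<lambda>v. v * (real n + 1) / n \<le> c)) \<longlonglongrightarrow> measure M {\<omega> \<in> space M. Z \<omega> \<le> c}"
proof -
  interpret prob_space M by fact
  interpret D: real_distribution "distr M borel Z"
    using assms(3) by (simp add: limiting_quicksort_distribution_def)
  have "\<exists>c\<in>{a<..<b}. c \<notin> {x. measure (distr M borel Z) {x} > 0}"
    using D.countable_atoms uncountable_open_interval[of a b] assms(4) countable_subset by (metis subsetI)
  then obtain c where c: "a < c" "c < b" "measure (distr M borel Z) {c} = 0"
    using measure_nonneg[of "distr M borel Z"] by (auto simp: not_less order_antisym)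
  have "(\<lambda>n. cdf (quicksort_normalized n) c) \<longlonglongrightarrow> cdf (distr M borel Z) c"
    using assms(3) c(3) D.isCont_cdf[of c]
    by (auto simp: limiting_quicksort_distribution_def weak_conv_m_def weak_conv_def)
  moreover have "cdf (distr M borel Z) c = measure M {\<omega> \<in> space M. Z \<omega> \<le> c}"
    unfolding cdf_def using assms(2) by (subst measure_distr) (auto intro!: arg_cong[where f = "measure M"])
  moreover have "cdf (quicksort_normalized n) c = qs_prob n (\<lambda>v. v * (real n + 1) / n \<le> c)" for n
    unfolding cdf_def quicksort_normalized_def qs_prob_def qs_dev_def
    by (subst measure_distr) (auto intro!: arg_cong[where f = "measure _"])
  ultimately show ?thesis using c that by simp
qed

lemma scaled_dev:
  assumes "n \<ge> 1"
  shows "v * (real n + 1) / n = v + v / n"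
  using assms by (simp add: field_simps)

lemma limit_left_lower:
  fixes x p :: real
  assumes M: "prob_space M" "Z \<in> borel_measurable M" "limiting_quicksort_distribution (distr M borel Z)"
    and x: "x \<ge> 0" and p: "\<forall>\<^sub>F n in sequentially. p \<le> qs_prob n (\<lambda>v. v \<le> - (x + 1))"
  shows "p \<le> measure M {\<omega> \<in> space M. Z \<omega> \<le> - x}"
proof -
  interpret prob_space M by fact
  obtain c where c: "- (x + 1) < c" "c < - x"
    "(\<lambda>n. qs_prob n (\<lambda>v. v * (real n + 1) / n \<le> c)) \<longlonglongrightarrow> measure M {\<omega> \<in> space M. Z \<omega> \<le> c}"
    using limiting_quicksort_cdf[OF M, of "- (x + 1)" "- x"] by auto
  have "\<forall>\<^sub>F n in sequentially. p \<le> qs_prob n (\<lambda>v. v * (real n + 1) / n \<le> c)"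
    using p eventually_ge_at_top[of 1]
  proof eventually_elim
    case (elim n)
    note elim(1)
    also have "qs_prob n (\<lambda>v. v \<le> - (x + 1)) \<le> qs_prob n (\<lambda>v. v * (real n + 1) / n \<le> c)"
    proof (rule qs_prob_mono)
      fix v assume v: "v \<le> - (x + 1)"
      then have "v / real n \<le> 0" using x by (intro divide_nonpos_nonneg) auto
      with v c show "v * (real n + 1) / n \<le> c" unfolding scaled_dev[OF elim(2)] by linarith
    qed
    finally show ?case .
  qed
  from tendsto_lowerbound[OF c(3) this] have "p \<le> measure M {\<omega> \<in> space M. Z \<omega> \<le> c}" by simp
  also have "\<dots> \<le> measure M {\<omega> \<in> space M. Z \<omega> \<le> - x}"
    using c M(2) by (intro finite_measure_mono) auto
  finally show ?thesis .
qed

lemma limit_left_upper: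
  fixes x p :: real
  assumes M: "prob_space M" "Z \<in> borel_measurable M" "limiting_quicksort_distribution (distr M borel Z)"
    and p: "\<And>n. qs_prob n (\<lambda>v. v \<le> - (x - 2)) \<le> p"
  shows "measure M {\<omega> \<in> space M. Z \<omega> \<le> - x} \<le> p"
proof -
  interpret prob_space M by fact
  obtain c where c: "- x < c" "c < - (x - 1)"
    "(\<lambda>n. qs_prob n (\<lambda>v. v * (real n + 1) / n \<le> c)) \<longlonglongrightarrow> measure M {\<omega> \<in> space M. Z \<omega> \<le> c}"
    using limiting_quicksort_cdf[OF M, of "- x" "- (x - 1)"] by auto
  have "\<forall>\<^sub>F n in sequentially. qs_prob n (\<lambda>v. v * (real n + 1) / n \<le> c) \<le> p"
    using eventually_ge_at_top[of "nat \<lceil>\<bar>x\<bar>\<rceil> + 1"]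
  proof eventually_elim
    case (elim n)
    then have n: "n \<ge> 1" "\<bar>x\<bar> \<le> n" by linarith+
    have "qs_prob n (\<lambda>v. v * (real n + 1) / n \<le> c) \<le> qs_prob n (\<lambda>v. v \<le> - (x - 2))"
    proof (rule qs_prob_mono)
      fix v assume "v * (real n + 1) / n \<le> c"
      then have "v * (real n + 1) \<le> c * n" using n by (simp add: field_simps)
      also have "\<dots> \<le> - (x - 1) * n" using c by (intro mult_right_mono) auto
      also have "\<dots> \<le> - (x - 2) * (real n + 1)" using n(2) by (simp add: algebra_simps)
      finally show "v \<le> - (x - 2)" by (rule mult_right_le_imp_le) simp
    qed
    with p[of n] show ?case by linarith
  qed
  from tendsto_upperbound[OF c(3) this] have "measure M {\<omega> \<in> space M. Z \<omega> \<le> c} \<le> p" by simp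
  moreover have "measure M {\<omega> \<in> space M. Z \<omega> \<le> - x} \<le> measure M {\<omega> \<in> space M. Z \<omega> \<le> c}"
    using c M(2) by (intro finite_measure_mono) auto
  ultimately show ?thesis by linarith
qed

lemma prob_greater_tendsto:
  assumes "prob_space M" "Z \<in> borel_measurable M"
    and "(\<lambda>n. qs_prob n (\<lambda>v. v * (real n + 1) / n \<le> c)) \<longlonglongrightarrow> measure M {\<omega> \<in> space M. Z \<omega> \<le> c}"
  shows "(\<lambda>n. qs_prob n (\<lambda>v. c < v * (real n + 1) / n)) \<longlonglongrightarrow> measure M {\<omega> \<in> space M. c < Z \<omega>}"
proof -
  interpret prob_space M by fact
  have "qs_prob n (\<lambda>v. c < v * (real n + 1) / n) = 1 - qs_prob n (\<lambda>v. v * (real n + 1) / n \<le> c)" for n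
    unfolding qs_prob_compl[symmetric] by (simp add: not_le)
  moreover have "measure M {\<omega> \<in> space M. c < Z \<omega>} = 1 - measure M {\<omega> \<in> space M. Z \<omega> \<le> c}"
    using assms(2) by (subst prob_compl[symmetric]) (auto intro!: arg_cong[where f = "measure M"])
  ultimately show ?thesis using tendsto_diff[OF tendsto_const[of 1] assms(3)] by simp
qed

lemma limit_right_lower:
  fixes x p :: real
  assumes M: "prob_space M" "Z \<in> borel_measurable M" "limiting_quicksort_distribution (distr M borel Z)"
    and x: "x \<ge> 0" and p: "\<forall>\<^sub>F n in sequentially. p \<le> qs_prob n (\<lambda>v. x + 1 \<le> v)"
  shows "p \<le> measure M {\<omega> \<in> space M. Z \<omega> \<ge> x}"
proof -
  interpret prob_space M by fact
  obtain c where c: "x < c" "c < x + 1"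
    "(\<lambda>n. qs_prob n (\<lambda>v. v * (real n + 1) / n \<le> c)) \<longlonglongrightarrow> measure M {\<omega> \<in> space M. Z \<omega> \<le> c}"
    using limiting_quicksort_cdf[OF M, of x "x + 1"] by auto
  have "\<forall>\<^sub>F n in sequentially. p \<le> qs_prob n (\<lambda>v. c < v * (real n + 1) / n)"
    using p eventually_ge_at_top[of 1]
  proof eventually_elim
    case (elim n)
    note elim(1)
    also have "qs_prob n (\<lambda>v. x + 1 \<le> v) \<le> qs_prob n (\<lambda>v. c < v * (real n + 1) / n)"
    proof (rule qs_prob_mono)
      fix v assume v: "x + 1 \<le> v"
      then have "v / real n \<ge> 0" using x by (intro divide_nonneg_nonneg) auto
      with v c show "c < v * (real n + 1) / n" unfolding scaled_dev[OF elim(2)] by linarith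
    qed
    finally show ?case .
  qed
  from tendsto_lowerbound[OF prob_greater_tendsto[OF M(1,2) c(3)] this]
  have "p \<le> measure M {\<omega> \<in> space M. c < Z \<omega>}" by simp
  also have "\<dots> \<le> measure M {\<omega> \<in> space M. Z \<omega> \<ge> x}"
    using c M(2) by (intro finite_measure_mono) auto
  finally show ?thesis .
qed

lemma limit_right_upper:
  fixes x p :: real
  assumes M: "prob_space M" "Z \<in> borel_measurable M" "limiting_quicksort_distribution (distr M borel Z)"
    and p: "\<And>n. qs_prob n (\<lambda>v. x - 2 \<le> v) \<le> p"
  shows "measure M {\<omega> \<in> space M. Z \<omega> \<ge> x} \<le> p"
proof -
  interpret prob_space M by fact
  obtain c where c: "x - 1 < c" "c < x"
    "(\<lambda>n. qs_prob n (\<lambda>v. v * (real n + 1) / n \<le> c)) \<longlonglongrightarrow> measure M {\<omega> \<in> space M. Z \<omega> \<le> c}"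
    using limiting_quicksort_cdf[OF M, of "x - 1" x] by auto
  have "\<forall>\<^sub>F n in sequentially. qs_prob n (\<lambda>v. c < v * (real n + 1) / n) \<le> p"
    using eventually_ge_at_top[of "nat \<lceil>\<bar>x\<bar>\<rceil> + 1"]
  proof eventually_elim
    case (elim n)
    then have n: "n \<ge> 1" "\<bar>x\<bar> \<le> n" by linarith+
    have "qs_prob n (\<lambda>v. c < v * (real n + 1) / n) \<le> qs_prob n (\<lambda>v. x - 2 \<le> v)"
    proof (rule qs_prob_mono)
      fix v assume "c < v * (real n + 1) / n"
      then have "c * n \<le> v * (real n + 1)" using n by (simp add: field_simps)
      moreover have "(x - 1) * n \<le> c * n" using c by (intro mult_right_mono) auto
      moreover have "(x - 2) * (real n + 1) \<le> (x - 1) * n" using n(2) by (simp add: algebra_simps)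
      ultimately have "(x - 2) * (real n + 1) \<le> v * (real n + 1)" by linarith
      then show "x - 2 \<le> v" by (rule mult_right_le_imp_le) simp
    qed
    with p[of n] show ?case by linarith
  qed
  from tendsto_upperbound[OF prob_greater_tendsto[OF M(1,2) c(3)] this]
  have "measure M {\<omega> \<in> space M. c < Z \<omega>} \<le> p" by simp
  moreover have "measure M {\<omega> \<in> space M. Z \<omega> \<ge> x} \<le> measure M {\<omega> \<in> space M. c < Z \<omega>}"
    using c M(2) by (intro finite_measure_mono) auto
  ultimately show ?thesis by linarith
qed

section \<open>The tails of the limit\<close>

text \<open>
  Taking \<open>\<delta> = 1 / sqrt x\<close> makes the total loss over the roughly \<open>x / (2 ln 2 - 1)\<close> steps bounded, while
  each step costs a factor \<open>x\<^bsup>-1/2\<^esup>\<close> up to a constant; this factor is the origin of the term \<open>ln (ln x)\<close>.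
  The exponent is right because \<open>\<gamma> = ln 2 / (2 ln 2 - 1)\<close>.
\<close>
lemma limiting_left_lower:
  fixes \<gamma> :: real
  assumes M: "prob_space M" "Z \<in> borel_measurable M" "limiting_quicksort_distribution (distr M borel Z)"
    and \<gamma>: "\<gamma> = inverse (2 - 1 / ln 2)"
  shows "\<exists>C. \<forall>\<^sub>F x in at_top. exp (- exp (\<gamma> * x + ln (ln x) + C)) \<le> measure M {\<omega> \<in> space M. Z \<omega> \<le> - x}"
proof -
  obtain K where K: "K \<ge> 0" "\<And>n. qs_prob n (\<lambda>v. v \<le> K) \<ge> 1 / 2"
    "\<And>n. qs_prob n (\<lambda>v. - K \<le> v) \<ge> 1 / 2"
    by (rule qs_prob_tight, rule that)
  define g where "g = 2 * ln 2 - (1::real)"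
  have g: "g \<ge> 1 / 3" "g > 0" using ln2_ge_two_thirds by (auto simp: g_def)
  have \<gamma>g: "\<gamma> = ln 2 / g" unfolding \<gamma> g_def by (simp add: field_simps)
  \<comment> \<open>A bound on the difference between the number of steps and \<open>x / g\<close>.\<close>
  define B where "B = 2 * (g * (K + 1) + 12) / g\<^sup>2 + 1"
  have "\<forall>\<^sub>F x in at_top. exp (- exp (\<gamma> * x + ln (ln x) + B * ln 2)) \<le> measure M {\<omega> \<in> space M. Z \<omega> \<le> - x}"
    using eventually_ge_at_top[of "72::real"]
  proof eventually_elim
    case (elim x)
    define \<delta> where "\<delta> = 1 / sqrt x"
    have d2: "\<delta>\<^sup>2 = 1 / x" using elim by (simp add: \<delta>_def power_divide)
    have "sqrt x \<ge> 4" using elim by (intro real_le_rsqrt) auto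
    then have d: "0 < \<delta>" "\<delta> \<le> 1 / 4"
      using elim divide_left_mono[of 4 "sqrt x" 1] by (auto simp: \<delta>_def)
    define L where "L = g - 12 * \<delta>\<^sup>2"
    have "12 / x \<le> 1 / 6" using elim by (simp add: field_simps)
    then have L: "L \<ge> g / 2" "L = g - 12 / x" using g by (auto simp: L_def d2)
    then have L0: "L > 0" using g by linarith
    define k where "k = nat \<lceil>(x + 1 + K) / L\<rceil>"
    have quo: "(x + 1 + K) / L \<ge> 0" using L0 elim K(1) by (intro divide_nonneg_nonneg) auto
    then have k: "(x + 1 + K) / L \<le> k" "k \<le> (x + 1 + K) / L + 1" unfolding k_def by linarith+
    have kL: "x + 1 + K \<le> k * L" using k(1) L0 by (simp add: field_simps)
    have "(x + 1 + K) / L - x / g = (g * (K + 1) + 12) / (g * L)"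
      using L0 g elim by (simp add: L(2) field_simps)
    also have "\<dots> \<le> (g * (K + 1) + 12) / (g * (g / 2))"
      using L g K(1) by (intro divide_left_mono mult_left_mono mult_pos_pos) auto
    also have "\<dots> = B - 1" by (simp add: B_def power2_eq_square)
    finally have kB: "k \<le> x / g + B" using k(2) by linarith
    obtain n0 where n0: "\<And>n. n \<ge> n0 \<Longrightarrow> 2 / \<delta> * (\<delta> / 4) ^ 2 ^ k \<le> qs_prob n (\<lambda>v. v \<le> K - k * L)"
      using qs_prob_left_lower[OF K(2) d, of k] by (auto simp: L_def g_def)
    have bound: "exp (- exp (\<gamma> * x + ln (ln x) + B * ln 2)) \<le> 2 / \<delta> * (\<delta> / 4) ^ 2 ^ k"
    proof -
      have lnx: "ln x \<ge> ln 72" using elim by simp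
      have "ln (72::real) > 0" by simp
      with lnx have lnx0: "ln x > 0" by linarith
      have "(2::real) ^ k = exp (k * ln 2)" by (simp add: exp_of_nat_mult)
      also have "\<dots> \<le> exp ((x / g + B) * ln 2)" using kB by simp
      also have "(x / g + B) * ln 2 = \<gamma> * x + B * ln 2" by (simp add: \<gamma>g algebra_simps)
      finally have pow: "(2::real) ^ k \<le> exp (\<gamma> * x + B * ln 2)" .
      have "ln (4 / \<delta>) = ln 4 + ln x / 2"
        using elim by (simp add: \<delta>_def ln_mult ln_sqrt)
      moreover have "ln (4::real) = ln 16 / 2" using ln_realpow[of 4 2] by simp
      moreover have "ln (16::real) \<le> ln x" using elim by simp
      ultimately have l4: "ln (4 / \<delta>) \<le> ln x" by simp
      have "0 \<le> ln (4 / \<delta>)" using d by (intro ln_ge_zero) (auto simp: field_simps)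
      then have "2 ^ k * ln (4 / \<delta>) \<le> exp (\<gamma> * x + B * ln 2) * ln x"
        using pow l4 by (intro mult_mono) auto
      also have "\<dots> = exp (\<gamma> * x + ln (ln x) + B * ln 2)" using lnx0 by (simp add: exp_add)
      finally have "exp (- exp (\<gamma> * x + ln (ln x) + B * ln 2)) \<le> exp (- (2 ^ k * ln (4 / \<delta>)))" by simp
      also have "- (2 ^ k * ln (4 / \<delta>)) = real (2 ^ k) * ln (\<delta> / 4)"
        using d by (simp add: ln_div right_diff_distrib)
      also have "exp \<dots> = (\<delta> / 4) ^ 2 ^ k" using d by (subst exp_of_nat_mult) simp
      also have "\<dots> \<le> 2 / \<delta> * (\<delta> / 4) ^ 2 ^ k" using d mult_right_mono[of 1 "2 / \<delta>" "(\<delta> / 4) ^ 2 ^ k"] by (simp add: field_simps)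
      finally show ?thesis .
    qed
    show ?case
    proof (rule limit_left_lower[OF M])
      show "x \<ge> 0" using elim by simp
      show "\<forall>\<^sub>F n in sequentially. exp (- exp (\<gamma> * x + ln (ln x) + B * ln 2)) \<le> qs_prob n (\<lambda>v. v \<le> - (x + 1))"
        using eventually_ge_at_top[of n0]
      proof eventually_elim
        case (elim n)
        note bound
        also note n0[OF elim]
        also have "qs_prob n (\<lambda>v. v \<le> K - k * L) \<le> qs_prob n (\<lambda>v. v \<le> - (x + 1))"
          using kL by (intro qs_prob_mono) linarith
        finally show ?case .
      qed
    qed
  qed
  then show ?thesis by blast
qed

text \<open>
  The Chernoff bound, with \<open>t\<close> chosen a constant factor below the optimum so that the exponent
  becomes \<open>1 - 2 t\<close>.
\<close>
lemma limiting_left_upper: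
  fixes \<gamma> :: real
  assumes M: "prob_space M" "Z \<in> borel_measurable M" "limiting_quicksort_distribution (distr M borel Z)"
    and \<gamma>: "\<gamma> = inverse (2 - 1 / ln 2)"
  shows "\<exists>C. \<forall>\<^sub>F x in at_top. measure M {\<omega> \<in> space M. Z \<omega> \<le> - x} \<le> exp (- exp (\<gamma> * x + C))"
proof -
  obtain c where c: "c \<ge> 0" "\<And>n t. t > 0 \<Longrightarrow> qs_mgf n (- t) \<le> exp (left_rate * (t * ln t) + c * t + 1)"
    using qs_mgf_left by blast
  have \<gamma>': "left_rate * \<gamma> = 1" "\<gamma> > 0"
    using left_rate_bounds unfolding \<gamma> left_rate_def[symmetric] by auto
  have "\<forall>\<^sub>F x in at_top. measure M {\<omega> \<in> space M. Z \<omega> \<le> - x} \<le> exp (- exp (\<gamma> * x + - \<gamma> * (4 + c)))"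
    using eventually_ge_at_top[of "4 + c"]
  proof eventually_elim
    case (elim x)
    \<comment> \<open>The value of \<open>t\<close> at which \<open>left_rate * ln t = x - (4 + c)\<close>.\<close>
    define t where "t = exp (\<gamma> * x + - \<gamma> * (4 + c))"
    have "\<gamma> * x + - \<gamma> * (4 + c) = \<gamma> * (x - (4 + c))" by (simp add: algebra_simps)
    also have "\<dots> \<ge> 0" using \<gamma>' elim by (intro mult_nonneg_nonneg) auto
    finally have t1: "t \<ge> 1" by (simp add: t_def)
    have "left_rate * ln t = (left_rate * \<gamma>) * (x - (4 + c))" by (simp add: t_def algebra_simps)
    then have lnt: "left_rate * ln t = x - (4 + c)" by (simp add: \<gamma>')
    have "measure M {\<omega> \<in> space M. Z \<omega> \<le> - x} \<le> exp (- t)"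
    proof (rule limit_left_upper[OF M])
      fix n
      have "qs_prob n (\<lambda>v. v \<le> - (x - 2)) \<le> qs_prob n (\<lambda>v. t * (x - 2) \<le> - t * v)"
      proof (rule qs_prob_mono)
        fix v assume "v \<le> - (x - 2)"
        then have "t * (x - 2) \<le> t * (- v)" using t1 by (intro mult_left_mono) auto
        then show "t * (x - 2) \<le> - t * v" by simp
      qed
      also have "\<dots> \<le> exp (- (t * (x - 2))) * qs_mgf n (- t)" by (rule qs_prob_Markov)
      also have "\<dots> \<le> exp (- (t * (x - 2))) * exp (left_rate * (t * ln t) + c * t + 1)"
        using t1 by (intro mult_left_mono c) auto
      also have "\<dots> = exp (- (t * (x - 2)) + (t * (left_rate * ln t) + c * t + 1))"
        unfolding exp_add[symmetric] by (simp only: mult.left_commute)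
      also have "\<dots> = exp (1 - 2 * t)" unfolding lnt by (simp add: algebra_simps)
      also have "\<dots> \<le> exp (- t)" using t1 by simp
      finally show "qs_prob n (\<lambda>v. v \<le> - (x - 2)) \<le> exp (- t)" .
    qed
    then show ?case by (simp add: t_def)
  qed
  then show ?thesis by blast
qed

text \<open>
  With \<open>\<delta> = 1 / (x ln x)\<close> each of the steps gains \<open>1 - O(1 / ln x)\<close>, so \<open>x + O(x / ln x)\<close> steps suffice, each
  at the price \<open>\<delta>\<close> up to a constant. This costs \<open>x ln x + x ln (ln x) + O(x)\<close> in the exponent.
\<close>
lemma limiting_right_lower:
  assumes M: "prob_space M" "Z \<in> borel_measurable M" "limiting_quicksort_distribution (distr M borel Z)"
  shows "\<exists>r\<in>O[at_top](\<lambda>x::real. x). \<forall>\<^sub>F x in at_top.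
    exp (- x * ln x - x * ln (ln x) + r x) \<le> measure M {\<omega> \<in> space M. Z \<omega> \<ge> x}"
proof -
  obtain K where K: "K \<ge> 0" "\<And>n. qs_prob n (\<lambda>v. v \<le> K) \<ge> 1 / 2"
    "\<And>n. qs_prob n (\<lambda>v. - K \<le> v) \<ge> 1 / 2"
    by (rule qs_prob_tight, rule that)
  \<comment> \<open>The target below is \<open>x + 1\<close>, as one unit is lost in the passage to the limit.\<close>
  define \<delta> :: "real \<Rightarrow> real" where "\<delta> x = 1 / (x * ln x)" for x
  define L where "L x = 1 - (\<delta> x * ((x + 1) + 2 * K + 4) - 2 * \<delta> x * ln (\<delta> x))" for x
  define r where "r x = x * ln x + x * ln (ln x) - (ln 2 + ((x + 1 + K) / L x + 1) * ln (4 / \<delta> x))" for x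
  have "r \<in> O[at_top](\<lambda>x. x)"
    unfolding r_def L_def \<delta>_def using K(1) by real_asymp
  moreover have "\<forall>\<^sub>F x in at_top. exp (- x * ln x - x * ln (ln x) + r x) \<le> measure M {\<omega> \<in> space M. Z \<omega> \<ge> x}"
  proof -
    have "\<forall>\<^sub>F x in at_top. 0 < \<delta> x" unfolding \<delta>_def by real_asymp
    moreover have "\<forall>\<^sub>F x in at_top. \<delta> x \<le> 1 / 4" unfolding \<delta>_def by real_asymp
    moreover have "\<forall>\<^sub>F x in at_top. 1 / 2 \<le> L x"
      unfolding L_def \<delta>_def using K(1) by real_asymp
    ultimately show ?thesis using eventually_ge_at_top[of "1::real"]
    proof eventually_elim
      case (elim x)
      define k where "k = nat \<lceil>(x + 1 + K) / L x\<rceil>"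
      have quo: "(x + 1 + K) / L x \<ge> 0" using elim K(1) by (intro divide_nonneg_nonneg) auto
      then have k: "(x + 1 + K) / L x \<le> k" "k \<le> (x + 1 + K) / L x + 1" unfolding k_def by linarith+
      have kL: "x + 1 + K \<le> k * L x" using k(1) elim by (simp add: field_simps)
      obtain n0 where n0: "\<And>n. n \<ge> n0 \<Longrightarrow> 1 / 2 * (\<delta> x / 4) ^ k \<le> qs_prob n (\<lambda>v. min (x + 1) (- K + k * L x) \<le> v)"
        using qs_prob_right_lower[OF K(1) K(3), of "\<delta> x" "x + 1" "L x" k] elim by (auto simp: L_def)
      have bound: "exp (- x * ln x - x * ln (ln x) + r x) \<le> 1 / 2 * (\<delta> x / 4) ^ k"
      proof -
        have d: "\<delta> x > 0" "\<delta> x \<le> 1 / 4" using elim by auto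
        have "0 \<le> ln (4 / \<delta> x)" using d by (intro ln_ge_zero) (auto simp: field_simps)
        then have "k * ln (4 / \<delta> x) \<le> ((x + 1 + K) / L x + 1) * ln (4 / \<delta> x)"
          using k(2) by (intro mult_right_mono)
        then have "exp (- x * ln x - x * ln (ln x) + r x) \<le> exp (- ln 2 - k * ln (4 / \<delta> x))"
          by (simp add: r_def)
        also have "- ln 2 - k * ln (4 / \<delta> x) = - ln 2 + k * ln (\<delta> x / 4)" using d by (simp add: ln_div algebra_simps)
        also have "exp \<dots> = exp (- ln 2) * (\<delta> x / 4) ^ k"
          using d by (subst exp_add, subst exp_of_nat_mult) simp
        also have "exp (- ln 2 :: real) = 1 / 2" by (simp add: exp_minus field_simps)
        finally show ?thesis .
      qed
      show ?case
      proof (rule limit_right_lower[OF M])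
        show "x \<ge> 0" using elim by simp
        show "\<forall>\<^sub>F n in sequentially. exp (- x * ln x - x * ln (ln x) + r x) \<le> qs_prob n (\<lambda>v. x + 1 \<le> v)"
          using eventually_ge_at_top[of n0]
        proof eventually_elim
          case (elim n)
          note bound
          also note n0[OF elim]
          also have "qs_prob n (\<lambda>v. min (x + 1) (- K + k * L x) \<le> v) \<le> qs_prob n (\<lambda>v. x + 1 \<le> v)"
            using kL by (intro qs_prob_mono) (auto simp: min_def split: if_splits)
          finally show ?case .
        qed
      qed
    qed
  qed
  ultimately show ?thesis by blast
qed

text \<open>
  The Chernoff bound at \<open>t = ln x\<close>, where the exponential moment is only \<open>exp (O(x))\<close>.
\<close>
lemma limiting_right_upper:
  assumes M: "prob_space M" "Z \<in> borel_measurable M" "limiting_quicksort_distribution (distr M borel Z)"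
  shows "\<forall>\<^sub>F x in at_top. measure M {\<omega> \<in> space M. Z \<omega> \<ge> x} \<le> exp (- x * ln x + 102 * x)"
  using eventually_ge_at_top[of "1::real"]
proof eventually_elim
  case (elim x)
  show ?case
  proof (rule limit_right_upper[OF M])
    fix n
    have l: "ln x \<ge> 0" "ln x \<le> x" using elim ln_le_minus_one[of x] by auto
    have "qs_prob n (\<lambda>v. x - 2 \<le> v) \<le> qs_prob n (\<lambda>v. ln x * (x - 2) \<le> ln x * v)"
      using l by (intro qs_prob_mono mult_left_mono) auto
    also have "\<dots> \<le> exp (- (ln x * (x - 2))) * qs_mgf n (ln x)" by (rule qs_prob_Markov)
    also have "\<dots> \<le> exp (- (ln x * (x - 2))) * exp (100 * (x - 1))"
      using qs_mgf_le_exp_exp[of n "ln x"] l elim by (intro mult_left_mono) auto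
    also have "\<dots> = exp (- x * ln x + (2 * ln x + 100 * x - 100))" by (simp add: algebra_simps flip: exp_add)
    also have "\<dots> \<le> exp (- x * ln x + 102 * x)" using l by simp
    finally show "qs_prob n (\<lambda>v. x - 2 \<le> v) \<le> exp (- x * ln x + 102 * x)" .
  qed
qed

theorem theorem1p1:
  fixes M :: "'a measure" and Z :: "'a \<Rightarrow> real" and \<gamma> :: real
  assumes "prob_space M"
    and "Z \<in> borel_measurable M"
    and "limiting_quicksort_distribution (distr M borel Z)"
    and "\<gamma> = inverse (2 - 1 / ln 2)"
  shows
    "(\<exists>r\<in>O[at_top](\<lambda>_. 1). \<forall>\<^sub>F x in at_top.
        exp (- exp (\<gamma> * x + ln (ln x) + r x)) \<le> \<P>(\<omega> in M. Z \<omega> \<le> - x)) \<and>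
     (\<exists>r\<in>O[at_top](\<lambda>_. 1). \<forall>\<^sub>F x in at_top.
        \<P>(\<omega> in M. Z \<omega> \<le> - x) \<le> exp (- exp (\<gamma> * x + r x))) \<and>
     (\<exists>r\<in>O[at_top](\<lambda>x. x). \<forall>\<^sub>F x in at_top.
        exp (- x * ln x - x * ln (ln x) + r x) \<le> \<P>(\<omega> in M. Z \<omega> \<ge> x)) \<and>
     (\<exists>r\<in>O[at_top](\<lambda>x. x). \<forall>\<^sub>F x in at_top.
        \<P>(\<omega> in M. Z \<omega> \<ge> x) \<le> exp (- x * ln x + r x))"
proof (intro conjI)
  note M = assms(1-3)
  obtain C where "\<forall>\<^sub>F x in at_top. exp (- exp (\<gamma> * x + ln (ln x) + C)) \<le> \<P>(\<omega> in M. Z \<omega> \<le> - x)"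
    using limiting_left_lower[OF assms] by blast
  then show "\<exists>r\<in>O[at_top](\<lambda>_. 1). \<forall>\<^sub>F x in at_top.
        exp (- exp (\<gamma> * x + ln (ln x) + r x)) \<le> \<P>(\<omega> in M. Z \<omega> \<le> - x)"
    by (intro bexI[of _ "\<lambda>_. C"]) auto
  obtain C' where "\<forall>\<^sub>F x in at_top. \<P>(\<omega> in M. Z \<omega> \<le> - x) \<le> exp (- exp (\<gamma> * x + C'))"
    using limiting_left_upper[OF assms] by blast
  then show "\<exists>r\<in>O[at_top](\<lambda>_. 1). \<forall>\<^sub>F x in at_top.
        \<P>(\<omega> in M. Z \<omega> \<le> - x) \<le> exp (- exp (\<gamma> * x + r x))"
    by (intro bexI[of _ "\<lambda>_. C'"]) auto
  show "\<exists>r\<in>O[at_top](\<lambda>x. x). \<forall>\<^sub>F x in at_top.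
        exp (- x * ln x - x * ln (ln x) + r x) \<le> \<P>(\<omega> in M. Z \<omega> \<ge> x)"
    using limiting_right_lower[OF M] .
  show "\<exists>r\<in>O[at_top](\<lambda>x. x). \<forall>\<^sub>F x in at_top.
        \<P>(\<omega> in M. Z \<omega> \<ge> x) \<le> exp (- x * ln x + r x)"
    using limiting_right_upper[OF M] by (intro bexI[of _ "\<lambda>x. 102 * x"]) auto
qed

end
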